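(* Let $B_\pi$ be the left quantum homogeneous space associated with a real coisotropic quantum left subgroup of a real quantum group $\mathcal{F}_q(G)$, with its left action $X.a$ of $\mathcal{U}_q$. Then: (i) If $h_1,h_2$ are two real functionals on $B_\pi$ that are $\xi$-equivalent, i.e. $h_1(a)=h_2(\xi^*a\xi)$ for all $a\in B_\pi$ with $\xi\in B_\pi$ invertible, and $h_2$ is quasi-invariant with weight $\phi_2$, then $h_1$ is quasi-invariant with weight $$\phi_1[X]=\sum_{(X)}X_{(1)}.\xi\;\phi_2[X_{(2)}]\;\xi^{-1}.$$ (ii) If $h$ is a quasi-invariant real functional on $B_\pi$ with weight $\phi$, and $k\in\mathcal{U}_q$ satisfies $\Delta(k)=k\otimes k$ (group-like) and $\tau(k)=k$, then the translated functional $h_k(a)=h(k.a)$ is a real functional equivalent to $h$, it is quasi-invariant with weight $$\phi_k[X]=\phi[XS(k)]\;S(k).\phi[k],$$ and it is positive if $h$ is positive. (iii) A real functional on $B_\pi$ is essentially invariant if and only if it is equivalent to an invariant one.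
   Context: $\mathcal{F}_q(G)$ is a Hopf $*$-algebra over $\mathbb{C}$ with coproduct $\Delta$, antipode $S$, and $\tau=*\circ S$, $\tau(a)=S(a)^*$, $\tau^2=\mathrm{id}$. $\mathcal{U}_q$ is the dual Hopf $*$-algebra, paired with $\mathcal{F}_q(G)$ by a Hopf algebra duality $X(a)=\langle X,a\rangle$ with $X^*(a)=\overline{X(\tau(a))}$; also $\tau(X)=S(X)^*$ on $\mathcal{U}_q$. Sweedler notation $\Delta X=\sum_{(X)}X_{(1)}\otimes X_{(2)}$ is used. A real coisotropic quantum left subgroup $(\mathcal{F}_q(K),\tau_K)$ is a coalgebra and left $\mathcal{F}_q(G)$-module with a surjective linear map $\pi:\mathcal{F}_q(G)\to\mathcal{F}_q(K)$ that is a morphism of coalgebras and of left $\mathcal{F}_q(G)$-modules, and with an antilinear map $\tau_K$ on $\mathcal{F}_q(K)$ such that $\tau_K\circ\pi=\pi\circ\tau$. The associated left homogeneous space is $B_\pi=\{a\in\mathcal{F}_q(G):(\pi\otimes\mathrm{id})\Delta a=\pi(1)\otimes a\}$, a $*$-subalgebra and right coideal of $\mathcal{F}_q(G)$. $\mathcal{U}_q$ acts on $\mathcal{F}_q(G)$, and by restriction on $B_\pi$, by $X.a=(\mathrm{id}\otimes X)\Delta a$. This satisfies $X.(ab)=\sum_{(X)}(X_{(1)}.a)(X_{(2)}.b)$, $X.1=\epsilon(X)1$, $(X.a)^*=\tau(X).a^*$. In products, the action binds tighter than multiplication: $X.a\,b=(X.a)b$. Definitions for a linear functional $h:B_\pi\to\mathbb{C}$.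 It is real if $h(a^* )=\overline{h(a)}$ for all $a$, and positive if moreover $h(a^*a)\ge 0$ for all $a\in B_\pi$. Two real functionals $h_1,h_2$ are $\xi$-equivalent if $\xi\in B_\pi$ is invertible (in $B_\pi$) and $h_1(a)=h_2(\xi^*a\xi)$ for all $a$; they are equivalent if they are $\xi$-equivalent for some invertible $\xi\in B_\pi$ (this is an equivalence relation). A real functional $h$ is quasi-invariant with weight $\phi$ if $\phi:\mathcal{U}_q\to B_\pi$ is a linear map with $\phi[XY]=\sum_{(X)}X_{(1)}.\phi[Y]\,\phi[X_{(2)}]$ and $\phi[1]=1$, and for all $X\in\mathcal{U}_q$, $a\in B_\pi$: $h(X.a)=\sum_{(X)}h\big(\phi[X_{(1)}^*]^*\,a\,\phi[S(X_{(2)})]\big)$. It is essentially invariant if it is quasi-invariant with a weight of the form $\phi[X]=X.\xi\;\xi^{-1}$ for some invertible $\xi\in B_\pi$. It is invariant if $h(X.a)=\epsilon(X)h(a)$ for all $X\in\mathcal{U}_q$, $a\in B_\pi$ (quasi-invariant with weight $\phi[X]=\epsilon(X)1$). *)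

theory Defs
  imports Complex_Main "HOL-Library.Multiset" "HOL-Library.Nonpos_Ints"
begin

class complex_vector = ab_group_add +
  fixes scaleC :: "complex \<Rightarrow> 'a \<Rightarrow> 'a"  (infixr \<open>*\<^sub>C\<close> 75)
  assumes scaleC_add_right: "c *\<^sub>C (x + y) = c *\<^sub>C x + c *\<^sub>C y"
    and scaleC_add_left: "(c + d) *\<^sub>C x = c *\<^sub>C x + d *\<^sub>C x"
    and scaleC_scaleC: "c *\<^sub>C (d *\<^sub>C x) = (c * d) *\<^sub>C x"
    and scaleC_one: "1 *\<^sub>C x = x"

global_interpretation complex_vector: vector_space "scaleC :: complex \<Rightarrow> 'a \<Rightarrow> 'a::complex_vector"
  by unfold_locales (simp_all add: scaleC_add_right scaleC_add_left scaleC_scaleC scaleC_one)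

class complex_algebra_1 = complex_vector + ring_1 +
  assumes mult_scaleC_left: "(c *\<^sub>C x) * y = c *\<^sub>C (x * y)"
    and mult_scaleC_right: "x * (c *\<^sub>C y) = c *\<^sub>C (x * y)"

instantiation complex :: complex_algebra_1
begin
definition scaleC_complex :: "complex \<Rightarrow> complex \<Rightarrow> complex"
  where "scaleC_complex c x = c * x"
instance
  by standard (simp_all add: scaleC_complex_def algebra_simps)
end

abbreviation clinear :: "('a::complex_vector \<Rightarrow> 'b::complex_vector) \<Rightarrow> bool"
  where "clinear \<equiv> Vector_Spaces.linear scaleC scaleC"

definition antilinear :: "('a::complex_vector \<Rightarrow> 'b::complex_vector) \<Rightarrow> bool"
  where "antilinear f \<longleftrightarrow>
    (\<forall>x y. f (x + y) = f x + f y) \<and> (\<forall>c x. f (c *\<^sub>C x) = cnj c *\<^sub>C f x)"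

text \<open>
  A multiset of pairs stands for the formal sum of the corresponding pure tensors. Scalars
  (in particular signs) are absorbed into the factors, so no coefficients are needed, and the
  relation below is the congruence generated by the usual relations of the tensor product.
\<close>

inductive tensor_rel ::
  "('a::complex_vector \<times> 'b::complex_vector) multiset \<Rightarrow> ('a \<times> 'b) multiset \<Rightarrow> bool" where
  refl: "tensor_rel M M"
| sym: "tensor_rel M N \<Longrightarrow> tensor_rel N M"
| trans: "tensor_rel M N \<Longrightarrow> tensor_rel N P \<Longrightarrow> tensor_rel M P"
| union: "tensor_rel M N \<Longrightarrow> tensor_rel M' N' \<Longrightarrow> tensor_rel (M + M') (N + N')"
| add_left: "tensor_rel {#(x + x', y)#} {#(x, y), (x', y)#}"
| add_right: "tensor_rel {#(x, y + y')#} {#(x, y), (x, y')#}"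
| scale: "tensor_rel {#(c *\<^sub>C x, y)#} {#(x, c *\<^sub>C y)#}"
| zero: "tensor_rel {#(0, y)#} {#}"

lemma equivp_tensor_rel: "equivp tensor_rel"
  by (rule equivpI)
    (auto intro!: reflpI sympI transpI intro: tensor_rel.refl tensor_rel.sym tensor_rel.trans)

quotient_type (overloaded) ('a, 'b) tensor =
    "('a::complex_vector \<times> 'b::complex_vector) multiset" / tensor_rel
  by (rule equivp_tensor_rel)

lift_definition pure_tensor :: "'a::complex_vector \<Rightarrow> 'b::complex_vector \<Rightarrow> ('a, 'b) tensor"
    (infixr \<open>\<otimes>\<close> 70)
  is "\<lambda>x y. {#(x, y)#}" .

lemma tensor_rel_scale:
  assumes "tensor_rel M N"
  shows "tensor_rel (image_mset (\<lambda>(x, y). (c *\<^sub>C x, y)) M) (image_mset (\<lambda>(x, y). (c *\<^sub>C x, y)) N)"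
  using assms
proof induction
  case (scale d x y)
  then show ?case
    using tensor_rel.scale[of d "c *\<^sub>C x" y] by (simp add: scaleC_scaleC mult.commute)
qed (auto intro: tensor_rel.intros simp: scaleC_add_right)

lemma tensor_rel_uminus:
  "tensor_rel (image_mset (\<lambda>(x, y). (- x, y)) M + M) {#}"
proof (induction M)
  case empty
  then show ?case by (simp add: tensor_rel.refl)
next
  case (add p M)
  obtain x y where p: "p = (x, y)" by (cases p)
  have "tensor_rel {#(- x, y), (x, y)#} {#}"
    using tensor_rel.add_left[of "- x" x y] tensor_rel.zero[of y]
    by (auto intro: tensor_rel.sym tensor_rel.trans)
  from tensor_rel.union[OF this add.IH] show ?case
    by (simp add: p add_ac)
qed

lemma tensor_rel_scale_add:
  "tensor_rel (image_mset (\<lambda>(x, y). ((c + d) *\<^sub>C x, y)) M)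
     (image_mset (\<lambda>(x, y). (c *\<^sub>C x, y)) M + image_mset (\<lambda>(x, y). (d *\<^sub>C x, y)) M)"
proof (induction M)
  case empty
  then show ?case by (simp add: tensor_rel.refl)
next
  case (add p M)
  obtain x y where p: "p = (x, y)" by (cases p)
  from tensor_rel.union[OF tensor_rel.add_left[of "c *\<^sub>C x" "d *\<^sub>C x" y] add.IH] show ?case
    by (simp add: p add_ac scaleC_add_left add_mset_commute)
qed

instantiation tensor :: (complex_vector, complex_vector) complex_vector
begin

lift_definition zero_tensor :: "('a, 'b) tensor" is "{#}" .

lift_definition plus_tensor :: "('a, 'b) tensor \<Rightarrow> ('a, 'b) tensor \<Rightarrow> ('a, 'b) tensor" is "(+)"
  by (rule tensor_rel.union)

lift_definition scaleC_tensor :: "complex \<Rightarrow> ('a, 'b) tensor \<Rightarrow> ('a, 'b) tensor"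
  is "\<lambda>c. image_mset (\<lambda>(x, y). (c *\<^sub>C x, y))"
  by (rule tensor_rel_scale)

definition uminus_tensor :: "('a, 'b) tensor \<Rightarrow> ('a, 'b) tensor"
  where "uminus_tensor t = (- 1) *\<^sub>C t"

definition minus_tensor :: "('a, 'b) tensor \<Rightarrow> ('a, 'b) tensor \<Rightarrow> ('a, 'b) tensor"
  where "minus_tensor s t = s + (- t)"

instance
proof
  fix s t u :: "('a, 'b) tensor" and c d :: complex
  show "s + t + u = s + (t + u)"
    by transfer (simp add: add.assoc tensor_rel.refl)
  show "s + t = t + s"
    by transfer (simp add: add.commute tensor_rel.refl)
  show "0 + t = t"
    by transfer (simp add: tensor_rel.refl)
  show "- t + t = 0"
    unfolding uminus_tensor_def by transfer (use tensor_rel_uminus in simp)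
  show "s - t = s + (- t)"
    by (simp add: minus_tensor_def)
  show "c *\<^sub>C (s + t) = c *\<^sub>C s + c *\<^sub>C t"
    by transfer (simp add: tensor_rel.refl)
  show "(c + d) *\<^sub>C t = c *\<^sub>C t + d *\<^sub>C t"
    by transfer (rule tensor_rel_scale_add)
  show "c *\<^sub>C (d *\<^sub>C t) = (c * d) *\<^sub>C t"
    by transfer (simp add: multiset.map_comp comp_def case_prod_unfold scaleC_scaleC tensor_rel.refl)
  show "1 *\<^sub>C t = t"
    by transfer (simp add: case_prod_unfold scaleC_one tensor_rel.refl)
qed

end

text \<open>
  The value of \<open>f\<close> on a tensor is computed on some representation as a sum of pure tensors.
  This is independent of the representation, and hence meaningful, for the balanced maps
  defined below, which include both the bilinear and the biantilinear ones.
\<close>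

definition tensor_lift ::
  "('a::complex_vector \<Rightarrow> 'b::complex_vector \<Rightarrow> 'c::ab_group_add) \<Rightarrow> ('a, 'b) tensor \<Rightarrow> 'c"
  where "tensor_lift f t = (\<Sum>(x, y)\<in>#rep_tensor t. f x y)"

definition balanced ::
  "('a::complex_vector \<Rightarrow> 'b::complex_vector \<Rightarrow> 'c::ab_group_add) \<Rightarrow> bool"
  where "balanced f \<longleftrightarrow>
    (\<forall>x x' y. f (x + x') y = f x y + f x' y) \<and>
    (\<forall>x y y'. f x (y + y') = f x y + f x y') \<and>
    (\<forall>c x y. f (c *\<^sub>C x) y = f x (c *\<^sub>C y))"

lemma tensor_rel_sum:
  assumes "balanced f" and "tensor_rel M N"
  shows "(\<Sum>(x, y)\<in>#M. f x y) = (\<Sum>(x, y)\<in>#N. f x y)"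
  using assms(2)
proof induction
  case (zero y)
  have "f (0 + 0) y = f 0 y + f 0 y"
    using assms(1) unfolding balanced_def by blast
  then show ?case by simp
qed (use assms(1) in \<open>auto simp: balanced_def\<close>)

lemma tensor_lift_abs:
  assumes "balanced f"
  shows "tensor_lift f (abs_tensor M) = (\<Sum>(x, y)\<in>#M. f x y)"
  unfolding tensor_lift_def
  by (rule tensor_rel_sum[OF assms])
    (metis Quotient3_tensor Quotient3_rep_abs tensor_rel.refl)

lemma tensor_lift_pure: "balanced f \<Longrightarrow> tensor_lift f (x \<otimes> y) = f x y"
  by (simp add: pure_tensor.abs_eq tensor_lift_abs)

lemma tensor_lift_add:
  assumes "balanced f"
  shows "tensor_lift f (s + t) = tensor_lift f s + tensor_lift f t"
proof -
  obtain M N where "s = abs_tensor M" "t = abs_tensor N"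
    by (metis Quotient3_abs_rep Quotient3_tensor)
  then show ?thesis
    using assms by (simp add: plus_tensor.abs_eq tensor_lift_abs)
qed

definition tensor_map ::
  "('a::complex_vector \<Rightarrow> 'c::complex_vector) \<Rightarrow> ('b::complex_vector \<Rightarrow> 'd::complex_vector) \<Rightarrow>
   ('a, 'b) tensor \<Rightarrow> ('c, 'd) tensor"
  where "tensor_map f g = tensor_lift (\<lambda>x y. f x \<otimes> g y)"

definition tensor_assoc ::
  "(('a::complex_vector, 'b::complex_vector) tensor, 'c::complex_vector) tensor \<Rightarrow>
   ('a, ('b, 'c) tensor) tensor"
  where "tensor_assoc = tensor_lift (\<lambda>t z. tensor_lift (\<lambda>x y. x \<otimes> (y \<otimes> z)) t)"

definition tensor_mult ::
  "('a::complex_algebra_1, 'b::complex_algebra_1) tensor \<Rightarrow> ('a, 'b) tensor \<Rightarrow> ('a, 'b) tensor"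
  where "tensor_mult s t = tensor_lift (\<lambda>a b. tensor_lift (\<lambda>c d. (a * c) \<otimes> (b * d)) t) s"

text \<open>
  The next three classes have no superclasses after the equality sign but a sort constraint in
  \<open>fixes\<close>, since \<open>tensor\<close>, \<open>clinear\<close>, etc. need that sort already inside the specification. The sort
  becomes a superclass all the same.
\<close>

class coalgebra =
  fixes comult :: "'a::complex_vector \<Rightarrow> ('a, 'a) tensor"
    and counit :: "'a \<Rightarrow> complex"
  assumes linear_comult: "clinear comult"
    and linear_counit: "clinear counit"
    and coassoc: "tensor_assoc (tensor_map comult id (comult a)) = tensor_map id comult (comult a)"
    and counit_left: "tensor_lift (\<lambda>x y. counit x *\<^sub>C y) (comult a) = a"
    and counit_right: "tensor_lift (\<lambda>x y. counit y *\<^sub>C x) (comult a) = a"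

class hopf_algebra =
  fixes antipode :: "'a::{complex_algebra_1, coalgebra} \<Rightarrow> 'a"
  assumes comult_mult: "comult (a * b) = tensor_mult (comult a) (comult b)"
    and comult_one: "comult 1 = 1 \<otimes> 1"
    and counit_mult: "counit (a * b) = counit a * counit b"
    and counit_one: "counit 1 = 1"
    and linear_antipode: "clinear antipode"
    and antipode_left: "tensor_lift (\<lambda>x y. antipode x * y) (comult a) = counit a *\<^sub>C 1"
    and antipode_right: "tensor_lift (\<lambda>x y. x * antipode y) (comult a) = counit a *\<^sub>C 1"

class hopf_star_algebra =
  fixes star :: "'a::hopf_algebra \<Rightarrow> 'a"
  assumes antilinear_star: "antilinear star"
    and star_star: "star (star a) = a"
    and star_mult: "star (a * b) = star b * star a"
    and comult_star: "comult (star a) = tensor_map star star (comult a)"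
    and counit_star: "counit (star a) = cnj (counit a)"

definition tau :: "'a::hopf_star_algebra \<Rightarrow> 'a"
  where "tau a = star (antipode a)"

text \<open>
  Sweedler notation: \<open>sweedler X (\<lambda>X\<^sub>1 X\<^sub>2. e)\<close> is the sum over \<open>(X)\<close> of \<open>e\<close>, for \<open>e\<close> balanced
  in \<open>(X\<^sub>1, X\<^sub>2)\<close>.
\<close>

definition sweedler ::
  "'a::coalgebra \<Rightarrow> ('a \<Rightarrow> 'a \<Rightarrow> 'b::ab_group_add) \<Rightarrow> 'b"
  where "sweedler X f = tensor_lift f (comult X)"

text \<open>\<open>0\<close> has to be excluded explicitly, since it satisfies the coproduct equation.\<close>

definition group_like :: "'a::coalgebra \<Rightarrow> bool"
  where "group_like k \<longleftrightarrow> comult k = k \<otimes> k \<and> k \<noteq> 0"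

locale hopf_star_pairing =
  fixes pair :: "'u::hopf_star_algebra \<Rightarrow> 'a::hopf_star_algebra \<Rightarrow> complex"
  assumes linear_left: "clinear (\<lambda>X. pair X a)"
    and linear_right: "clinear (pair X)"
    and pair_mult_left: "pair (X * Y) a = sweedler a (\<lambda>a1 a2. pair X a1 * pair Y a2)"
    and pair_mult_right: "pair X (a * b) = sweedler X (\<lambda>X1 X2. pair X1 a * pair X2 b)"
    and pair_one_left: "pair 1 a = counit a"
    and pair_one_right: "pair X 1 = counit X"
    and pair_antipode: "pair (antipode X) a = pair X (antipode a)"
    and pair_star: "pair (star X) a = cnj (pair X (tau a))"

text \<open>
  The quantum subgroup is the coalgebra \<open>'k\<close> with the left module structure \<open>mact\<close>. Compatibility of
  its coproduct with \<open>mact\<close> follows from surjectivity of \<open>\<pi>\<close>.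
\<close>

locale real_coisotropic_left_subgroup =
  fixes mact :: "'a::hopf_star_algebra \<Rightarrow> 'k::coalgebra \<Rightarrow> 'k"
    and \<pi> :: "'a \<Rightarrow> 'k"
    and \<tau>\<^sub>K :: "'k \<Rightarrow> 'k"
  assumes mact_linear_left: "clinear (\<lambda>a. mact a v)"
    and mact_linear_right: "clinear (mact a)"
    and mact_one: "mact 1 v = v"
    and mact_mult: "mact (a * b) v = mact a (mact b v)"
    and linear_pi: "clinear \<pi>"
    and surj_pi: "surj \<pi>"
    and comult_pi: "comult (\<pi> a) = tensor_map \<pi> \<pi> (comult a)"
    and counit_pi: "counit (\<pi> a) = counit a"
    and pi_mult: "\<pi> (a * b) = mact a (\<pi> b)"
    and antilinear_tau: "antilinear \<tau>\<^sub>K"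
    and tau_pi: "\<tau>\<^sub>K (\<pi> a) = \<pi> (tau a)"

definition homogeneous_space :: "('a::hopf_star_algebra \<Rightarrow> 'k::coalgebra) \<Rightarrow> 'a set"
  where "homogeneous_space \<pi> = {a. tensor_map \<pi> id (comult a) = \<pi> 1 \<otimes> a}"

definition action ::
  "('u::hopf_star_algebra \<Rightarrow> 'a::hopf_star_algebra \<Rightarrow> complex) \<Rightarrow> 'u \<Rightarrow> 'a \<Rightarrow> 'a"
  where "action pair X a = sweedler a (\<lambda>a1 a2. pair X a2 *\<^sub>C a1)"

text \<open>
  A functional on \<open>homogeneous_space \<pi>\<close> is represented by a function on the whole Hopf algebra;
  only its values on the subspace matter.
\<close>

definition real_functional ::
  "('a::hopf_star_algebra \<Rightarrow> 'k::coalgebra) \<Rightarrow> ('a \<Rightarrow> complex) \<Rightarrow> bool"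
  where "real_functional \<pi> h \<longleftrightarrow>
    (\<forall>a\<in>homogeneous_space \<pi>. \<forall>b\<in>homogeneous_space \<pi>. h (a + b) = h a + h b) \<and>
    (\<forall>c. \<forall>a\<in>homogeneous_space \<pi>. h (c *\<^sub>C a) = c * h a) \<and>
    (\<forall>a\<in>homogeneous_space \<pi>. h (star a) = cnj (h a))"

definition positive_functional ::
  "('a::hopf_star_algebra \<Rightarrow> 'k::coalgebra) \<Rightarrow> ('a \<Rightarrow> complex) \<Rightarrow> bool"
  where "positive_functional \<pi> h \<longleftrightarrow>
    real_functional \<pi> h \<and> (\<forall>a\<in>homogeneous_space \<pi>. h (star a * a) \<in> \<real>\<^sub>\<ge>\<^sub>0)"

definition invertible_in :: "'a::ring_1 set \<Rightarrow> 'a \<Rightarrow> bool"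
  where "invertible_in A x \<longleftrightarrow> x \<in> A \<and> (\<exists>y\<in>A. x * y = 1 \<and> y * x = 1)"

definition inverse_in :: "'a::ring_1 set \<Rightarrow> 'a \<Rightarrow> 'a"
  where "inverse_in A x = (THE y. y \<in> A \<and> x * y = 1 \<and> y * x = 1)"

definition xi_equivalent ::
  "('a::hopf_star_algebra \<Rightarrow> 'k::coalgebra) \<Rightarrow> 'a \<Rightarrow> ('a \<Rightarrow> complex) \<Rightarrow> ('a \<Rightarrow> complex) \<Rightarrow> bool"
  where "xi_equivalent \<pi> \<xi> h1 h2 \<longleftrightarrow>
    real_functional \<pi> h1 \<and> real_functional \<pi> h2 \<and> invertible_in (homogeneous_space \<pi>) \<xi> \<and>
    (\<forall>a\<in>homogeneous_space \<pi>. h1 a = h2 (star \<xi> * a * \<xi>))"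

definition equivalent ::
  "('a::hopf_star_algebra \<Rightarrow> 'k::coalgebra) \<Rightarrow> ('a \<Rightarrow> complex) \<Rightarrow> ('a \<Rightarrow> complex) \<Rightarrow> bool"
  where "equivalent \<pi> h1 h2 \<longleftrightarrow> (\<exists>\<xi>. xi_equivalent \<pi> \<xi> h1 h2)"

definition is_weight ::
  "('u::hopf_star_algebra \<Rightarrow> 'a::hopf_star_algebra \<Rightarrow> complex) \<Rightarrow> ('a \<Rightarrow> 'k::coalgebra) \<Rightarrow>
   ('u \<Rightarrow> 'a) \<Rightarrow> bool"
  where "is_weight pair \<pi> \<phi> \<longleftrightarrow>
    clinear \<phi> \<and> range \<phi> \<subseteq> homogeneous_space \<pi> \<and>
    (\<forall>X Y. \<phi> (X * Y) = sweedler X (\<lambda>X1 X2. action pair X1 (\<phi> Y) * \<phi> X2)) \<and>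
    \<phi> 1 = 1"

definition quasi_invariant ::
  "('u::hopf_star_algebra \<Rightarrow> 'a::hopf_star_algebra \<Rightarrow> complex) \<Rightarrow> ('a \<Rightarrow> 'k::coalgebra) \<Rightarrow>
   ('a \<Rightarrow> complex) \<Rightarrow> ('u \<Rightarrow> 'a) \<Rightarrow> bool"
  where "quasi_invariant pair \<pi> h \<phi> \<longleftrightarrow>
    real_functional \<pi> h \<and> is_weight pair \<pi> \<phi> \<and>
    (\<forall>X. \<forall>a\<in>homogeneous_space \<pi>. h (action pair X a) =
      sweedler X (\<lambda>X1 X2. h (star (\<phi> (star X1)) * a * \<phi> (antipode X2))))"

definition essentially_invariant ::
  "('u::hopf_star_algebra \<Rightarrow> 'a::hopf_star_algebra \<Rightarrow> complex) \<Rightarrow> ('a \<Rightarrow> 'k::coalgebra) \<Rightarrow>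
   ('a \<Rightarrow> complex) \<Rightarrow> bool"
  where "essentially_invariant pair \<pi> h \<longleftrightarrow>
    (\<exists>\<xi>. invertible_in (homogeneous_space \<pi>) \<xi> \<and>
      quasi_invariant pair \<pi> h (\<lambda>X. action pair X \<xi> * inverse_in (homogeneous_space \<pi>) \<xi>))"

definition invariant ::
  "('u::hopf_star_algebra \<Rightarrow> 'a::hopf_star_algebra \<Rightarrow> complex) \<Rightarrow> ('a \<Rightarrow> 'k::coalgebra) \<Rightarrow>
   ('a \<Rightarrow> complex) \<Rightarrow> bool"
  where "invariant pair \<pi> h \<longleftrightarrow>
    real_functional \<pi> h \<and> (\<forall>X. \<forall>a\<in>homogeneous_space \<pi>. h (action pair X a) = counit X * h a)"

end

theory Submission
  imports Defs
begin

text \<open>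
  For a weight \<open>\<phi>\<close> the map \<open>a \<mapsto> \<Sum> X\<^sub>1.a \<phi>[X\<^sub>2]\<close> is a twisted action of \<open>\<U>\<^sub>q\<close> on \<open>B\<^sub>\<pi>\<close>, and \<open>h\<close> is
  quasi-invariant with weight \<open>\<phi>\<close> iff this is a \<open>*\<close>-representation for the form \<open>h(a\<^sup>* b)\<close>. It
  suffices to test this on \<open>a = 1\<close>, which gives the antipode-free condition
  \<open>h(\<phi>[X\<^sup>*]\<^sup>* b) = \<Sum> h(X\<^sub>1.b \<phi>[X\<^sub>2])\<close>. In this form (i) is a short computation with convolution
  products, based on \<open>(X.\<xi>)\<^sup>* = \<tau>(X).\<xi>\<^sup>*\<close> and \<open>\<Sum> X\<^sub>2 \<tau>(X\<^sub>1\<^sup>*) = \<epsilon>(X)\<close>. Part (ii) is the case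
  \<open>\<xi> = \<phi>[S(k)]\<close>, with inverse \<open>S(k).\<phi>[k]\<close>, and (iii) is (i) for the trivial weight \<open>\<epsilon>\<close>, with \<open>\<xi>\<close>
  or with \<open>\<xi>\<^sup>-\<^sup>1\<close>.
\<close>

section \<open>Sweedler calculus\<close>

named_theorems linear_intros

lemma clinear_iff:
  "clinear f \<longleftrightarrow> (\<forall>x y. f (x + y) = f x + f y) \<and> (\<forall>c x. f (c *\<^sub>C x) = c *\<^sub>C f x)"
  by (simp add: Vector_Spaces.linear_iff complex_vector.vector_space_axioms)

lemma clinear_add: "clinear f \<Longrightarrow> f (x + y) = f x + f y"
  and clinear_scaleC: "clinear f \<Longrightarrow> f (c *\<^sub>C x) = c *\<^sub>C f x"
  by (auto simp: clinear_iff)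

lemma clinear_zero: "clinear f \<Longrightarrow> f 0 = 0"
  using clinear_add[of f 0 0] by simp

lemma clinear_ident [linear_intros]: "clinear (\<lambda>x. x)"
  by (simp add: clinear_iff)

lemma clinear_mult_left [linear_intros]: "clinear f \<Longrightarrow> clinear (\<lambda>x. f x * (c :: 'b::complex_algebra_1))"
  by (simp add: clinear_iff distrib_right mult_scaleC_left)

lemma clinear_mult_right [linear_intros]: "clinear f \<Longrightarrow> clinear (\<lambda>x. (c :: 'b::complex_algebra_1) * f x)"
  by (simp add: clinear_iff distrib_left mult_scaleC_right)

lemma clinear_scaleC_left [linear_intros]: "clinear f \<Longrightarrow> clinear (\<lambda>x. f x *\<^sub>C c)"
  by (simp add: clinear_iff scaleC_add_left scaleC_scaleC scaleC_complex_def)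

lemma clinear_scaleC_right [linear_intros]: "clinear f \<Longrightarrow> clinear (\<lambda>x. d *\<^sub>C f x)"
  by (simp add: clinear_iff scaleC_add_right scaleC_scaleC mult.commute)

lemma clinear_comp: "clinear g \<Longrightarrow> clinear f \<Longrightarrow> clinear (\<lambda>x. g (f x))"
  by (simp add: clinear_iff)

text \<open>\<open>balanced\<close> only makes \<open>tensor_lift\<close> independent of the
  representation and also admits biantilinear maps. Bilinearity makes \<open>tensor_lift\<close>
  linear as well, and its two clauses can be discharged by \<open>linear_intros\<close>.\<close>

definition cbilinear ::
  "('a::complex_vector \<Rightarrow> 'b::complex_vector \<Rightarrow> 'c::complex_vector) \<Rightarrow> bool"
  where "cbilinear f \<longleftrightarrow> (\<forall>y. clinear (\<lambda>x. f x y)) \<and> (\<forall>x. clinear (f x))"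

lemma cbilinearI [linear_intros]:
  "(\<And>y. clinear (\<lambda>x. f x y)) \<Longrightarrow> (\<And>x. clinear (\<lambda>y. f x y)) \<Longrightarrow> cbilinear f"
  by (simp add: cbilinear_def)

lemma balanced_cbilinear: "cbilinear f \<Longrightarrow> balanced f"
  by (simp add: cbilinear_def balanced_def clinear_iff)

lemma abs_tensor_cases: obtains M where "t = abs_tensor M"
  by (metis Quotient3_abs_rep Quotient3_tensor)

lemma tensor_lift_scaleC:
  assumes "cbilinear f"
  shows "tensor_lift f (c *\<^sub>C t) = c *\<^sub>C tensor_lift f t"
proof -
  obtain M where t: "t = abs_tensor M" by (rule abs_tensor_cases)
  have "(\<Sum>(x, y)\<in>#image_mset (\<lambda>(x, y). (c *\<^sub>C x, y)) M. f x y) = c *\<^sub>C (\<Sum>(x, y)\<in>#M. f x y)"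
    using assms by (induction M) (auto simp: cbilinear_def clinear_iff scaleC_add_right)
  then show ?thesis
    by (simp add: t scaleC_tensor.abs_eq tensor_lift_abs balanced_cbilinear assms)
qed

lemma clinear_tensor_lift: "cbilinear f \<Longrightarrow> clinear (tensor_lift f)"
  by (simp add: clinear_iff tensor_lift_scaleC tensor_lift_add balanced_cbilinear)

lemma clinear_tensor_lift_arg [linear_intros]:
  "cbilinear f \<Longrightarrow> clinear g \<Longrightarrow> clinear (\<lambda>x. tensor_lift f (g x))"
  by (rule clinear_comp[OF clinear_tensor_lift])

text \<open>Both sides sum over the same multiset \<open>rep_tensor t\<close>, so an additive map
  passes inside. Asking for additivity rather than linearity lets the antilinear \<open>star\<close>
  through.\<close>

lemma additive_tensor_lift:
  fixes g :: "'c::ab_group_add \<Rightarrow> 'd::ab_group_add"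
  assumes "\<And>x y. g (x + y) = g x + g y"
  shows "g (tensor_lift f t) = tensor_lift (\<lambda>x y. g (f x y)) t"
proof -
  have "g 0 = 0"
    using assms[of 0 0] by simp
  then have "g (\<Sum>(x, y)\<in>#M. f x y) = (\<Sum>(x, y)\<in>#M. g (f x y))" for M
    by (induction M) (auto simp: assms)
  then show ?thesis by (simp add: tensor_lift_def)
qed

lemma clinear_tensor_lift_fun [linear_intros]:
  assumes "\<And>x y. clinear (\<lambda>p. F p x y)"
  shows "clinear (\<lambda>p. tensor_lift (F p) t)"
proof -
  have "clinear (\<lambda>p. \<Sum>(x, y)\<in>#M. F p x y)" for M
    using assms by (induction M) (auto simp: clinear_iff scaleC_add_right)
  then show ?thesis by (simp add: tensor_lift_def)
qed

lemma tensor_lift_swap: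
  "tensor_lift (\<lambda>x y. tensor_lift (F x y) s) t = tensor_lift (\<lambda>u v. tensor_lift (\<lambda>x y. F x y u v) t) s"
  unfolding tensor_lift_def case_prod_unfold by (rule sum_mset.swap)

section \<open>Pure tensors\<close>

lemma pure_add_left: "(x + y) \<otimes> z = x \<otimes> z + y \<otimes> z"
  by transfer (simp add: tensor_rel.add_left add_mset_commute)

lemma pure_add_right: "z \<otimes> (x + y) = z \<otimes> x + z \<otimes> y"
  by transfer (simp add: tensor_rel.add_right add_mset_commute)

lemma pure_scaleC_left: "(c *\<^sub>C x) \<otimes> z = c *\<^sub>C (x \<otimes> z)"
  by transfer (simp add: tensor_rel.refl)

lemma pure_scaleC_right: "z \<otimes> (c *\<^sub>C x) = c *\<^sub>C (z \<otimes> x)"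
  by transfer (simp add: tensor_rel.scale tensor_rel.sym)

lemma clinear_pure_left [linear_intros]: "clinear f \<Longrightarrow> clinear (\<lambda>x. f x \<otimes> z)"
  by (simp add: clinear_iff pure_add_left pure_scaleC_left)

lemma clinear_pure_right [linear_intros]: "clinear f \<Longrightarrow> clinear (\<lambda>x. z \<otimes> f x)"
  by (simp add: clinear_iff pure_add_right pure_scaleC_right)

lemma tensor_lift_pure_bilinear [simp]: "cbilinear f \<Longrightarrow> tensor_lift f (x \<otimes> y) = f x y"
  by (simp add: tensor_lift_pure balanced_cbilinear)

lemma tensor_lift_pure_tensor: "tensor_lift (\<otimes>) t = t"
proof -
  have *: "cbilinear (\<otimes>)" by (intro linear_intros)
  obtain M where t: "t = abs_tensor M" by (rule abs_tensor_cases)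
  have "(\<Sum>(x, y)\<in>#M. x \<otimes> y) = abs_tensor M"
    by (induction M) (auto simp: zero_tensor.abs_eq plus_tensor.abs_eq pure_tensor.abs_eq)
  then show ?thesis
    by (simp add: t tensor_lift_abs balanced_cbilinear *)
qed

lemma tensor_lift_tensor_lift:
  "cbilinear F \<Longrightarrow> tensor_lift F (tensor_lift G t) = tensor_lift (\<lambda>x y. tensor_lift F (G x y)) t"
  by (rule additive_tensor_lift) (simp add: tensor_lift_add balanced_cbilinear)

lemma tensor_lift_tensor_map:
  "cbilinear F \<Longrightarrow> tensor_lift F (tensor_map f g t) = tensor_lift (\<lambda>x y. F (f x) (g y)) t"
  by (simp add: tensor_map_def tensor_lift_tensor_lift)

section \<open>Coalgebra and Hopf axioms in Sweedler notation\<close>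

lemma clinear_counit [linear_intros]: "clinear f \<Longrightarrow> clinear (\<lambda>x. counit (f x))"
  by (rule clinear_comp[OF linear_counit])

lemma clinear_antipode [linear_intros]: "clinear f \<Longrightarrow> clinear (\<lambda>x. antipode (f x))"
  by (rule clinear_comp[OF linear_antipode])

lemma clinear_sweedler_arg [linear_intros]:
  "cbilinear F \<Longrightarrow> clinear f \<Longrightarrow> clinear (\<lambda>x. sweedler (f x) F)"
  unfolding sweedler_def by (rule clinear_tensor_lift_arg[OF _ clinear_comp[OF linear_comult]])

lemma clinear_sweedler_fun [linear_intros]:
  "(\<And>x y. clinear (\<lambda>p. F p x y)) \<Longrightarrow> clinear (\<lambda>p. sweedler X (F p))"
  unfolding sweedler_def by (intro linear_intros)

lemma additive_sweedler:
  "(\<And>x y. g (x + y) = g x + g y) \<Longrightarrow> g (sweedler X f) = sweedler X (\<lambda>x y. g (f x y))"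
  unfolding sweedler_def by (rule additive_tensor_lift)

lemma clinear_sweedler: "clinear g \<Longrightarrow> g (sweedler X f) = sweedler X (\<lambda>x y. g (f x y))"
  by (rule additive_sweedler) (simp add: clinear_iff)

lemma sweedler_mult_left: "sweedler X f * (c::'b::complex_algebra_1) = sweedler X (\<lambda>x y. f x y * c)"
  and sweedler_mult_right: "c * sweedler X f = sweedler X (\<lambda>x y. c * f x y)"
  by (rule additive_sweedler; simp add: algebra_simps)+

lemma sweedler_swap:
  "sweedler X (\<lambda>x y. sweedler Y (F x y)) = sweedler Y (\<lambda>u v. sweedler X (\<lambda>x y. F x y u v))"
  unfolding sweedler_def by (rule tensor_lift_swap)

text \<open>A trilinear \<open>f\<close> induces a linear map on threefold tensors, and this map is
  applied to both sides of \<open>coassoc\<close>.\<close>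

lemma sweedler_assoc:
  assumes "\<And>y z. clinear (\<lambda>x. f x y z)" "\<And>x z. clinear (\<lambda>y. f x y z)" "\<And>x y. clinear (f x y)"
  shows "sweedler X (\<lambda>x z. sweedler x (\<lambda>u v. f u v z)) = sweedler X (\<lambda>x y. sweedler y (f x))"
proof -
  have f: "cbilinear (f x)" "cbilinear (\<lambda>u v. f u v z)" for x z
    using assms by (auto simp: cbilinear_def)
  have F: "cbilinear (\<lambda>x. tensor_lift (f x))"
    by (intro linear_intros f assms)
  have G: "cbilinear (\<lambda>t z. tensor_lift (\<lambda>x y. f x y z) t)"
    by (intro linear_intros f assms)
  have "tensor_lift (\<lambda>x. tensor_lift (f x)) (tensor_assoc (tensor_map comult id (comult X))) =
      tensor_lift (\<lambda>x. tensor_lift (f x)) (tensor_map id comult (comult X))"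
    by (simp add: coassoc)
  then show ?thesis
    unfolding sweedler_def
    by (simp add: tensor_assoc_def tensor_lift_tensor_lift tensor_lift_tensor_map F G f)
qed

lemma sweedler_counit_left: "clinear f \<Longrightarrow> sweedler X (\<lambda>x y. counit x *\<^sub>C f y) = f X"
  using clinear_sweedler[of f X "\<lambda>x y. counit x *\<^sub>C y"]
  by (simp add: clinear_iff sweedler_def counit_left)

lemma sweedler_counit_right: "clinear f \<Longrightarrow> sweedler X (\<lambda>x y. counit y *\<^sub>C f x) = f X"
  using clinear_sweedler[of f X "\<lambda>x y. counit y *\<^sub>C x"]
  by (simp add: clinear_iff sweedler_def counit_right)

lemma sweedler_mult:
  "cbilinear F \<Longrightarrow>
    sweedler (X * Y) F = sweedler X (\<lambda>x x'. sweedler Y (\<lambda>y y'. F (x * y) (x' * y')))"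
  for X :: "'a::hopf_algebra"
  by (simp add: sweedler_def comult_mult tensor_mult_def tensor_lift_tensor_lift)

lemma sweedler_one: "cbilinear F \<Longrightarrow> sweedler (1::'a::hopf_algebra) F = F 1 1"
  by (simp add: sweedler_def comult_one)

lemma sweedler_antipode_left:
  assumes "clinear f"
  shows "sweedler X (\<lambda>x y. f (antipode x * y)) = counit X *\<^sub>C f 1"
  using clinear_sweedler[OF assms, of X "\<lambda>x y. antipode x * y"] assms
  by (simp add: sweedler_def antipode_left clinear_iff)

lemma sweedler_antipode_right:
  assumes "clinear f"
  shows "sweedler X (\<lambda>x y. f (x * antipode y)) = counit X *\<^sub>C f 1"
  using clinear_sweedler[OF assms, of X "\<lambda>x y. x * antipode y"] assms
  by (simp add: sweedler_def antipode_right clinear_iff)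

section \<open>Hopf \<open>*\<close>-algebras\<close>

lemma sweedler_cong: "(\<And>x y. f x y = g x y) \<Longrightarrow> sweedler X f = sweedler X g"
  by (metis ext)

lemma scaleC_sweedler: "c *\<^sub>C sweedler X f = sweedler X (\<lambda>x y. c *\<^sub>C f x y)"
  by (rule additive_sweedler) (rule scaleC_add_right)

lemma antipode_one [simp]: "antipode (1::'a::hopf_algebra) = 1"
  using sweedler_antipode_left[of "\<lambda>x. x" "1::'a"]
  by (simp add: sweedler_one linear_intros counit_one scaleC_one)

text \<open>Both sides are convolution inverses of multiplication, \<open>S(ab)\<close> from the
  left and \<open>S(b)S(a)\<close> from the right, so the sum of \<open>S(a\<^sub>1b\<^sub>1)
  a\<^sub>2b\<^sub>2 S(b\<^sub>3)S(a\<^sub>3)\<close> contracts to either.\<close>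

lemma antipode_mult: "antipode (a * b) = antipode b * antipode (a::'a::hopf_algebra)"
proof -
  let ?S = "antipode :: 'a \<Rightarrow> 'a"
  have MR: "sweedler a (\<lambda>x y. sweedler b (\<lambda>u v. c * (x * u * (?S v * ?S y))))
      = counit a *\<^sub>C counit b *\<^sub>C c" for a b c
  proof -
    have "sweedler b (\<lambda>u v. c * (x * u * (?S v * ?S y))) = counit b *\<^sub>C (c * (x * ?S y))" for x y
      using sweedler_antipode_right[of "\<lambda>z. c * (x * z * ?S y)" b]
      by (simp add: mult.assoc linear_intros)
    then show ?thesis
      using sweedler_antipode_right[of "\<lambda>z. counit b *\<^sub>C (c * z)" a] by (simp add: linear_intros)
  qed
  have LM: "sweedler a (\<lambda>x y. sweedler b (\<lambda>u v. ?S (x * u) * (y * v) * c))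
      = counit a *\<^sub>C counit b *\<^sub>C c" for a b c
  proof -
    have "sweedler (a * b) (\<lambda>x y. ?S x * y * c) = counit (a * b) *\<^sub>C c"
      using sweedler_antipode_left[of "\<lambda>z. z * c" "a * b"] by (simp add: linear_intros)
    moreover have "sweedler (a * b) (\<lambda>x y. ?S x * y * c)
        = sweedler a (\<lambda>x y. sweedler b (\<lambda>u v. ?S (x * u) * (y * v) * c))"
      by (rule sweedler_mult) (intro linear_intros)
    ultimately show ?thesis by (simp add: counit_mult scaleC_scaleC)
  qed
  have "?S (a * b) = sweedler a (\<lambda>x y. counit y *\<^sub>C sweedler b (\<lambda>u v. counit v *\<^sub>C ?S (x * u)))"
    by (subst sweedler_counit_right; (intro linear_intros)?)
      (rule sweedler_counit_right[symmetric], intro linear_intros)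
  also have "\<dots> = sweedler a (\<lambda>x y. sweedler b (\<lambda>u v. counit y *\<^sub>C counit v *\<^sub>C ?S (x * u)))"
    by (simp only: scaleC_sweedler)
  also have "\<dots> = sweedler a (\<lambda>x y. sweedler b (\<lambda>u v. sweedler y (\<lambda>y z. sweedler v (\<lambda>v w.
      ?S (x * u) * (y * v * (?S w * ?S z))))))"
    by (simp only: MR)
  \<comment> \<open>For \<open>a\<close> and then for \<open>b\<close>, coassociativity moves the
    nesting from the second leg to the first, until \<open>LM\<close> can contract the left
    pair.\<close>
  also have "\<dots> = sweedler a (\<lambda>x y. sweedler y (\<lambda>y z. sweedler b (\<lambda>u v. sweedler v (\<lambda>v w.
      ?S (x * u) * (y * v) * (?S w * ?S z)))))"
    by (subst (2) sweedler_swap) (simp only: mult.assoc)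
  also have "\<dots> = sweedler a (\<lambda>x z. sweedler x (\<lambda>x y. sweedler b (\<lambda>u v. sweedler v (\<lambda>v w.
      ?S (x * u) * (y * v) * (?S w * ?S z)))))"
    by (rule sweedler_assoc[symmetric]; intro linear_intros)
  also have "\<dots> = sweedler a (\<lambda>x z. sweedler x (\<lambda>x y. sweedler b (\<lambda>u w. sweedler u (\<lambda>u v.
      ?S (x * u) * (y * v) * (?S w * ?S z)))))"
    by (intro sweedler_cong sweedler_assoc[symmetric]; intro linear_intros)
  also have "\<dots> = sweedler a (\<lambda>x z. sweedler b (\<lambda>u w. sweedler x (\<lambda>x y. sweedler u (\<lambda>u v.
      ?S (x * u) * (y * v) * (?S w * ?S z)))))"
    by (subst (2) sweedler_swap) simp
  also have "\<dots> = sweedler a (\<lambda>x z. sweedler b (\<lambda>u w. counit x *\<^sub>C counit u *\<^sub>C (?S w * ?S z)))"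
    by (simp only: LM)
  also have "\<dots> = sweedler a (\<lambda>x z. counit x *\<^sub>C sweedler b (\<lambda>u w. counit u *\<^sub>C (?S w * ?S z)))"
    by (simp only: scaleC_sweedler)
  also have "\<dots> = ?S b * ?S a"
    by (subst sweedler_counit_left; (intro linear_intros)?)
      (rule sweedler_counit_left, intro linear_intros)
  finally show ?thesis .
qed

text \<open>The same uniqueness of convolution inverses, now with values in the tensor square: the
  coproduct of \<open>S(a)\<close> and the flipped sum of
  \<open>S(a\<^sub>2) \<otimes> S(a\<^sub>1)\<close> both invert the coproduct. All tensors are
  tested against the bilinear map \<open>F\<close>.\<close>

lemma sweedler_antipode:
  fixes a :: "'a::hopf_algebra"
  assumes "cbilinear F"
  shows "sweedler (antipode a) F = sweedler a (\<lambda>x y. F (antipode y) (antipode x))"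
proof -
  let ?S = "antipode :: 'a \<Rightarrow> 'a"
  have F [linear_intros]: "clinear f \<Longrightarrow> clinear (\<lambda>x. F (f x) c)" "clinear f \<Longrightarrow> clinear (\<lambda>x. F c (f x))"
    for c and f :: "'z::complex_vector \<Rightarrow> 'a"
    using assms by (auto simp: cbilinear_def clinear_iff)
  have MR: "sweedler c (\<lambda>c d. sweedler c (\<lambda>p q. sweedler d (\<lambda>r s. F (u * p * ?S s) (v * q * ?S r))))
      = counit c *\<^sub>C F u v" for c u v
  proof -
    have "sweedler c (\<lambda>c d. sweedler c (\<lambda>p q. sweedler d (\<lambda>r s. F (u * p * ?S s) (v * q * ?S r))))
      = sweedler c (\<lambda>p d. sweedler d (\<lambda>q d. sweedler d (\<lambda>r s. F (u * p * ?S s) (v * q * ?S r))))"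
      by (rule sweedler_assoc; intro linear_intros)
    \<comment> \<open>The adjacent legs \<open>q\<close> and \<open>r\<close> are grouped so that
      they cancel first; this makes \<open>p\<close> and \<open>s\<close> adjacent for the second
      cancellation.\<close>
    also have "\<dots> = sweedler c (\<lambda>p d. sweedler d (\<lambda>q s. sweedler q (\<lambda>q r. F (u * p * ?S s) (v * q * ?S r))))"
      by (intro sweedler_cong sweedler_assoc[symmetric]; intro linear_intros)
    also have "\<dots> = sweedler c (\<lambda>p d. sweedler d (\<lambda>q s. counit q *\<^sub>C F (u * p * ?S s) v))"
    proof (intro sweedler_cong)
      fix p d q s
      show "sweedler q (\<lambda>q r. F (u * p * ?S s) (v * q * ?S r)) = counit q *\<^sub>C F (u * p * ?S s) v"
        using sweedler_antipode_right[of "\<lambda>z. F (u * p * ?S s) (v * z)" q]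
        by (simp add: mult.assoc linear_intros)
    qed
    also have "\<dots> = sweedler c (\<lambda>p s. F (u * p * ?S s) v)"
      by (intro sweedler_cong sweedler_counit_left linear_intros)
    also have "\<dots> = counit c *\<^sub>C F u v"
      using sweedler_antipode_right[of "\<lambda>z. F (u * z) v" c] by (simp add: mult.assoc linear_intros)
    finally show ?thesis .
  qed
  have LM: "sweedler b (\<lambda>a c. sweedler (?S a) (\<lambda>u v. sweedler c (\<lambda>p q.
        sweedler d (\<lambda>r s. F (u * p * ?S s) (v * q * ?S r)))))
      = counit b *\<^sub>C sweedler d (\<lambda>r s. F (?S s) (?S r))" for b d
  proof -
    let ?G = "\<lambda>m n. sweedler d (\<lambda>r s. F (m * ?S s) (n * ?S r))"
    have G: "cbilinear ?G" by (intro linear_intros)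
    have "sweedler b (\<lambda>a c. sweedler (?S a) (\<lambda>u v. sweedler c (\<lambda>p q. ?G (u * p) (v * q))))
        = sweedler b (\<lambda>a c. sweedler (?S a * c) ?G)"
      by (intro sweedler_cong sweedler_mult[symmetric] G)
    also have "\<dots> = counit b *\<^sub>C sweedler 1 ?G"
      by (rule sweedler_antipode_left) (intro linear_intros)
    also have "\<dots> = counit b *\<^sub>C sweedler d (\<lambda>r s. F (?S s) (?S r))"
      by (subst sweedler_one[OF G]) simp
    finally show ?thesis .
  qed
  have "sweedler (?S a) F = sweedler a (\<lambda>a c. counit c *\<^sub>C sweedler (?S a) F)"
    by (rule sweedler_counit_right[symmetric]) (intro linear_intros assms)
  also have "\<dots> = sweedler a (\<lambda>a c. sweedler (?S a) (\<lambda>u v. counit c *\<^sub>C F u v))"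
    by (simp only: scaleC_sweedler)
  also have "\<dots> = sweedler a (\<lambda>a c. sweedler (?S a) (\<lambda>u v. sweedler c (\<lambda>c d.
      sweedler c (\<lambda>p q. sweedler d (\<lambda>r s. F (u * p * ?S s) (v * q * ?S r))))))"
    by (simp only: MR)
  also have "\<dots> = sweedler a (\<lambda>a c. sweedler c (\<lambda>c d. sweedler (?S a) (\<lambda>u v.
      sweedler c (\<lambda>p q. sweedler d (\<lambda>r s. F (u * p * ?S s) (v * q * ?S r))))))"
    by (intro sweedler_cong) (rule sweedler_swap)
  also have "\<dots> = sweedler a (\<lambda>a d. sweedler a (\<lambda>a c. sweedler (?S a) (\<lambda>u v.
      sweedler c (\<lambda>p q. sweedler d (\<lambda>r s. F (u * p * ?S s) (v * q * ?S r))))))"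
    by (rule sweedler_assoc[symmetric]; intro linear_intros)
  also have "\<dots> = sweedler a (\<lambda>a d. counit a *\<^sub>C sweedler d (\<lambda>r s. F (?S s) (?S r)))"
    by (simp only: LM)
  also have "\<dots> = sweedler a (\<lambda>r s. F (?S s) (?S r))"
    by (rule sweedler_counit_left) (intro linear_intros)
  finally show ?thesis .
qed

section \<open>The star operation and the inverse of the antipode\<close>

lemma star_add: "star (a + b) = star a + star (b::'a::hopf_star_algebra)"
  and star_scaleC: "star (c *\<^sub>C a) = cnj c *\<^sub>C star (a::'a::hopf_star_algebra)"
  using antilinear_star by (auto simp: antilinear_def)

lemma star_one [simp]: "star (1::'a::hopf_star_algebra) = 1"
  by (metis mult.left_neutral mult.right_neutral star_mult star_star)

lemma star_sweedler: "star (sweedler X f) = sweedler X (\<lambda>x y. star (f x y))"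
  by (rule additive_sweedler) (rule star_add)

lemma sweedler_star:
  "cbilinear f \<Longrightarrow> sweedler (star X) f = sweedler X (\<lambda>x y. f (star x) (star y))"
  by (simp add: sweedler_def comult_star tensor_lift_tensor_map)

text \<open>Two antilinear maps compose to a linear one. Hence \<open>tau (star x)\<close> is linear
  in \<open>x\<close> and stays within the bilinear calculus, although \<open>tau\<close> is
  antilinear.\<close>

lemma clinear_star_star:
  "clinear f \<Longrightarrow> clinear (\<lambda>x. star (f (star x)))"
  by (simp add: clinear_iff star_add star_scaleC)

lemma clinear_tau_star [linear_intros]: "clinear f \<Longrightarrow> clinear (\<lambda>x. tau (star (f x)))"
  unfolding tau_def by (rule clinear_comp[OF clinear_star_star[OF linear_antipode]])

text \<open>The map \<open>tau (star x)\<close> behaves like the inverse antipode: applying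
  \<open>star\<close> to the antipode axiom at \<open>star X\<close> reverses the product, so the
  second leg comes to stand on the left.\<close>

lemma sweedler_tau_star_left:
  assumes "clinear f"
  shows "sweedler X (\<lambda>x y. f (tau (star y) * x)) = counit X *\<^sub>C f 1"
proof -
  have "star (sweedler (star X) (\<lambda>x y. x * antipode y)) = star (counit (star X) *\<^sub>C 1)"
    by (subst sweedler_antipode_right) (simp_all add: linear_intros)
  then have "sweedler X (\<lambda>x y. tau (star y) * x) = counit X *\<^sub>C 1"
    by (simp add: sweedler_star linear_intros star_sweedler star_mult star_star tau_def
        star_scaleC counit_star)
  then show ?thesis
    using clinear_sweedler[OF assms, of X "\<lambda>x y. tau (star y) * x"] assms by (simp add: clinear_iff)
qed

lemma sweedler_tau_star_right:
  assumes "clinear f"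
  shows "sweedler X (\<lambda>x y. f (y * tau (star x))) = counit X *\<^sub>C f 1"
proof -
  have "star (sweedler (star X) (\<lambda>x y. antipode x * y)) = star (counit (star X) *\<^sub>C 1)"
    by (subst sweedler_antipode_left) (simp_all add: linear_intros)
  then have "sweedler X (\<lambda>x y. y * tau (star x)) = counit X *\<^sub>C 1"
    by (simp add: sweedler_star linear_intros star_sweedler star_mult star_star tau_def
        star_scaleC counit_star)
  then show ?thesis
    using clinear_sweedler[OF assms, of X "\<lambda>x y. y * tau (star x)"] assms by (simp add: clinear_iff)
qed

text \<open>With \<open>T(x) = tau (star x)\<close>, the sum of
  \<open>a\<^sub>1 S(a\<^sub>2) S(T(a\<^sub>3))\<close> is evaluated in two ways: by the antipode
  axiom on the first two factors, or by merging the last two into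
  \<open>S(T(a\<^sub>3) a\<^sub>2)\<close>. At \<open>star a\<close> this says that
  \<open>tau\<close> is an involution.\<close>

lemma antipode_tau_star: "antipode (tau (star a)) = (a::'a::hopf_star_algebra)"
proof -
  let ?S = "antipode :: 'a \<Rightarrow> 'a" and ?T = "\<lambda>a::'a. tau (star a)"
  have "?S (?T a) = sweedler a (\<lambda>x y. counit x *\<^sub>C ?S (?T y))"
    by (rule sweedler_counit_left[symmetric]) (intro linear_intros)
  also have "\<dots> = sweedler a (\<lambda>x z. sweedler x (\<lambda>x y. x * ?S y * ?S (?T z)))"
  proof (intro sweedler_cong)
    fix x z
    show "counit x *\<^sub>C ?S (?T z) = sweedler x (\<lambda>x y. x * ?S y * ?S (?T z))"
      using sweedler_antipode_right[of "\<lambda>w. w * ?S (?T z)" x] by (simp add: linear_intros)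
  qed
  also have "\<dots> = sweedler a (\<lambda>x y. sweedler y (\<lambda>y z. x * ?S y * ?S (?T z)))"
    by (rule sweedler_assoc; intro linear_intros)
  also have "\<dots> = sweedler a (\<lambda>x y. counit y *\<^sub>C x)"
  proof (intro sweedler_cong)
    fix x y
    show "sweedler y (\<lambda>y z. x * ?S y * ?S (?T z)) = counit y *\<^sub>C x"
      using sweedler_tau_star_left[of "\<lambda>w. x * ?S w" y] by (simp add: linear_intros antipode_mult mult.assoc)
  qed
  also have "\<dots> = a"
    by (rule sweedler_counit_right) (intro linear_intros)
  finally show ?thesis .
qed

section \<open>Subspaces, inverses and convolution\<close>

lemma sweedler_subspace:
  assumes "complex_vector.subspace S" "\<And>x y. f x y \<in> S"
  shows "sweedler X f \<in> S"
proof -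
  have "(\<Sum>(x, y)\<in>#M. f x y) \<in> S" for M
    by (induction M)
      (auto simp: assms complex_vector.subspace_0 complex_vector.subspace_add)
  then show ?thesis by (simp add: sweedler_def tensor_lift_def)
qed

text \<open>\<open>inverse_in\<close> is a definite description, so it is pinned down by uniqueness:
  a right inverse \<open>z\<close> equals \<open>y * x * z\<close>, hence \<open>y\<close>.\<close>

lemma inverse_in:
  assumes "invertible_in A x"
  shows "inverse_in A x \<in> A" "x * inverse_in A x = 1" "inverse_in A x * x = 1"
proof -
  obtain y where y: "y \<in> A" "x * y = 1" "y * x = 1"
    using assms by (auto simp: invertible_in_def)
  have "z = y" if "x * z = 1" for z
  proof -
    have "z = y * x * z" by (simp only: y mult_1_left)
    also have "\<dots> = y" by (simp only: mult.assoc that mult_1_right)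
    finally show ?thesis .
  qed
  with y have "inverse_in A x = y"
    unfolding inverse_in_def by blast
  with y show "inverse_in A x \<in> A" "x * inverse_in A x = 1" "inverse_in A x * x = 1"
    by simp_all
qed

text \<open>The convolution product of maps from a coalgebra to an algebra. Written with it,
  computations with weights and with \<open>\<lambda>X. act X a\<close> reduce to
  associativity.\<close>

definition conv :: "('c::coalgebra \<Rightarrow> 'a::complex_algebra_1) \<Rightarrow> ('c \<Rightarrow> 'a) \<Rightarrow> 'c \<Rightarrow> 'a"
  where "conv f g X = sweedler X (\<lambda>x y. f x * g y)"

lemma clinear_conv:
  assumes "clinear f" "clinear g"
  shows "clinear (conv f g)"
  unfolding conv_def
  by (intro linear_intros clinear_comp[OF assms(1)] clinear_comp[OF assms(2)])

lemma conv_assoc: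
  assumes "clinear f" "clinear g" "clinear h"
  shows "conv (conv f g) h = conv f (conv g h)"
proof
  fix X
  note [linear_intros] = clinear_comp[OF assms(1)] clinear_comp[OF assms(2)] clinear_comp[OF assms(3)]
  show "conv (conv f g) h X = conv f (conv g h) X"
    unfolding conv_def sweedler_mult_left sweedler_mult_right mult.assoc
    by (rule sweedler_assoc; intro linear_intros)
qed

lemma conv_mult_right: "conv f (\<lambda>X. g X * c) X = conv f g X * c"
  by (simp add: conv_def sweedler_mult_left mult.assoc)

lemma conv_counit_right: "clinear f \<Longrightarrow> conv f (\<lambda>X. counit X *\<^sub>C 1) X = f X"
  by (simp add: conv_def mult_scaleC_right sweedler_counit_right)

section \<open>Group-like elements\<close>

lemma group_like_counit:
  assumes "group_like k"
  shows "counit k = 1"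
proof -
  have "counit k *\<^sub>C k = k"
    using sweedler_counit_left[OF clinear_ident, of k] assms
    by (simp add: sweedler_def group_like_def linear_intros)
  \<comment> \<open>The counit axiom only gives \<open>counit k *\<^sub>C k = k\<close>; the
    condition \<open>k \<noteq> 0\<close> in \<open>group_like\<close> permits cancelling
    \<open>k\<close>.\<close>
  then have "(counit k - 1) *\<^sub>C k = 0"
    by (simp add: complex_vector.scale_left_diff_distrib scaleC_one)
  then show ?thesis
    using assms by (simp add: group_like_def)
qed

lemma sweedler_group_like: "group_like k \<Longrightarrow> cbilinear F \<Longrightarrow> sweedler k F = F k k"
  by (simp add: sweedler_def group_like_def)

lemma group_like_antipode_mult:
  assumes "group_like k"
  shows "antipode k * k = 1" "k * antipode k = 1"
  using sweedler_antipode_left[OF clinear_ident, of k] sweedler_antipode_right[OF clinear_ident, of k]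
  by (simp_all add: sweedler_group_like assms linear_intros group_like_counit scaleC_one)

lemma group_like_antipode:
  fixes k :: "'a::hopf_algebra"
  assumes "group_like k"
  shows "group_like (antipode k)"
proof -
  have "comult (antipode k) = sweedler (antipode k) (\<otimes>)"
    by (simp add: sweedler_def tensor_lift_pure_tensor)
  also have "\<dots> = antipode k \<otimes> antipode k"
    by (simp add: sweedler_antipode sweedler_group_like assms linear_intros)
  finally show ?thesis
    using group_like_antipode_mult[OF assms] assms by (auto simp: group_like_def)
qed

section \<open>The action on the homogeneous space\<close>

text \<open>\<open>real_functional\<close> constrains \<open>h\<close> on the subspace only, whereas
  the Sweedler rules need a map that is linear everywhere. The linear map fixed by the values of
  \<open>h\<close> on a basis of the subspace can stand in for it.\<close>

lemma real_functional_extend: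
  assumes "complex_vector.subspace (homogeneous_space \<pi>)" "real_functional \<pi> h"
  obtains g where "clinear g" "\<And>a. a \<in> homogeneous_space \<pi> \<Longrightarrow> g a = h a"
proof -
  let ?B = "homogeneous_space \<pi>"
  interpret vector_space_pair "scaleC :: complex \<Rightarrow> 'a \<Rightarrow> 'a" "scaleC :: complex \<Rightarrow> complex \<Rightarrow> complex"
    by unfold_locales
  obtain S where S: "S \<subseteq> ?B" "complex_vector.independent S" "?B \<subseteq> complex_vector.span S"
    using complex_vector.maximal_independent_subset[of ?B] by metis
  obtain g where g: "clinear g" "\<And>x. x \<in> S \<Longrightarrow> g x = h x"
    using linear_independent_extend[OF S(2)] by metis
  have hadd: "h (a + b) = h a + h b" "h (c *\<^sub>C a) = c * h a" if "a \<in> ?B" "b \<in> ?B" for a b c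
    using assms(2) that by (auto simp: real_functional_def)
  have "complex_vector.subspace {a \<in> ?B. g a = h a}"
    using assms(1) hadd g(1) hadd(2)[of 0 0 0] clinear_zero[OF g(1)]
    by (auto simp: complex_vector.subspace_def clinear_iff scaleC_complex_def)
  then have "complex_vector.span S \<subseteq> {a \<in> ?B. g a = h a}"
    using S(1) g(2) by (intro complex_vector.span_minimal) auto
  with S(3) show thesis
    by (intro that[OF g(1)]) auto
qed

locale coisotropic_pairing =
  hopf_star_pairing pair + real_coisotropic_left_subgroup mact \<pi> \<tau>\<^sub>K
  for pair :: "'u::hopf_star_algebra \<Rightarrow> 'a::hopf_star_algebra \<Rightarrow> complex"
    and mact :: "'a \<Rightarrow> 'k::coalgebra \<Rightarrow> 'k"
    and \<pi> :: "'a \<Rightarrow> 'k"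
    and \<tau>\<^sub>K :: "'k \<Rightarrow> 'k"
begin

abbreviation "act \<equiv> action pair"
abbreviation "B \<equiv> homogeneous_space \<pi>"

section \<open>The action, its module algebra property and the star\<close>

lemma clinear_pair_left [linear_intros]: "clinear f \<Longrightarrow> clinear (\<lambda>x. pair (f x) a)"
  by (rule clinear_comp[OF linear_left])

lemma clinear_pair_right [linear_intros]: "clinear f \<Longrightarrow> clinear (\<lambda>x. pair X (f x))"
  by (rule clinear_comp[OF linear_right])

lemma clinear_pi [linear_intros]: "clinear f \<Longrightarrow> clinear (\<lambda>x. \<pi> (f x))"
  by (rule clinear_comp[OF linear_pi])

lemma clinear_mact_left [linear_intros]: "clinear f \<Longrightarrow> clinear (\<lambda>x. mact (f x) v)"
  by (rule clinear_comp[OF mact_linear_left])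

lemma clinear_mact_right [linear_intros]: "clinear f \<Longrightarrow> clinear (\<lambda>x. mact a (f x))"
  by (rule clinear_comp[OF mact_linear_right])

lemma clinear_act_left [linear_intros]: "clinear f \<Longrightarrow> clinear (\<lambda>x. act (f x) a)"
  unfolding action_def by (intro linear_intros)

lemma clinear_act_right [linear_intros]: "clinear f \<Longrightarrow> clinear (\<lambda>x. act X (f x))"
  unfolding action_def by (intro linear_intros)

lemma clinear_act: "clinear (act X)" "clinear (\<lambda>X. act X a)"
  by (intro linear_intros)+

lemma act_unit [simp]: "act 1 a = a"
  by (simp add: action_def pair_one_left sweedler_counit_right linear_intros)

lemma act_one [simp]: "act X 1 = counit X *\<^sub>C 1"
  by (simp add: action_def sweedler_one pair_one_right linear_intros)

lemma act_act: "act X (act Y a) = act (X * Y) a"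
proof -
  have "act (X * Y) a = sweedler a (\<lambda>x y. sweedler y (\<lambda>y z. (pair X y * pair Y z) *\<^sub>C x))"
    unfolding action_def pair_mult_left
    by (intro sweedler_cong clinear_sweedler[where g = "\<lambda>z. z *\<^sub>C _"] linear_intros)
  also have "\<dots> = sweedler a (\<lambda>x z. sweedler x (\<lambda>x y. (pair X y * pair Y z) *\<^sub>C x))"
    by (rule sweedler_assoc[symmetric]; intro linear_intros)
  also have "\<dots> = sweedler a (\<lambda>x z. pair Y z *\<^sub>C act X x)"
    by (simp add: action_def scaleC_sweedler scaleC_scaleC mult.commute)
  also have "\<dots> = act X (act Y a)"
    unfolding action_def[of pair Y]
    by (simp add: clinear_sweedler[OF clinear_act(1)] clinear_scaleC[OF clinear_act(1)])
  finally show ?thesis ..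
qed

text \<open>The pairing turns the product of the second legs of \<open>a\<close> and
  \<open>b\<close> into the coproduct of \<open>X\<close>. The form with \<open>conv\<close>
  combines with \<open>conv_assoc\<close>.\<close>

lemma act_mult: "act X (a * b) = conv (\<lambda>X. act X a) (\<lambda>X. act X b) X"
proof -
  have "act X (a * b) = sweedler a (\<lambda>x x'. sweedler b (\<lambda>y y'. pair X (x' * y') *\<^sub>C (x * y)))"
    unfolding action_def by (rule sweedler_mult) (intro linear_intros)
  also have "\<dots> = sweedler a (\<lambda>x x'. sweedler b (\<lambda>y y'.
      sweedler X (\<lambda>u v. (pair u x' * pair v y') *\<^sub>C (x * y))))"
    unfolding pair_mult_right
    by (intro sweedler_cong clinear_sweedler[where g = "\<lambda>z. z *\<^sub>C _"] linear_intros)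
  also have "\<dots> = sweedler a (\<lambda>x x'. sweedler X (\<lambda>u v. sweedler b (\<lambda>y y'.
      (pair u x' * pair v y') *\<^sub>C (x * y))))"
    by (intro sweedler_cong sweedler_swap)
  also have "\<dots> = sweedler X (\<lambda>u v. sweedler a (\<lambda>x x'. sweedler b (\<lambda>y y'.
      (pair u x' * pair v y') *\<^sub>C (x * y))))"
    by (rule sweedler_swap)
  also have "\<dots> = conv (\<lambda>X. act X a) (\<lambda>X. act X b) X"
    unfolding conv_def action_def sweedler_mult_left
    by (simp add: sweedler_mult_right mult_scaleC_left mult_scaleC_right scaleC_scaleC mult.commute)
  finally show ?thesis .
qed

lemma star_act: "star (act X a) = act (tau X) (star a)"
proof -
  \<comment> \<open>\<open>pair_star\<close> puts \<open>tau (star y)\<close> under the conjugation,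
    and the antipode moved across by \<open>pair_antipode\<close> undoes it.\<close>
  have "pair (tau X) (star y) = cnj (pair X y)" for y
    by (simp add: tau_def[of X] pair_star pair_antipode antipode_tau_star)
  then show ?thesis
    by (simp add: action_def star_sweedler sweedler_star linear_intros star_scaleC)
qed

section \<open>Closure properties of the homogeneous space\<close>

lemma homogeneous_space_iff: "a \<in> B \<longleftrightarrow> sweedler a (\<lambda>x y. \<pi> x \<otimes> y) = \<pi> 1 \<otimes> a"
  by (simp add: homogeneous_space_def sweedler_def tensor_map_def)

text \<open>The defining equation of \<open>B\<close> tested on a bilinear map: a first leg that
  enters only through \<open>\<pi>\<close> collapses to \<open>\<pi> 1\<close>.\<close>

lemma sweedler_homogeneous:
  assumes "a \<in> B" "cbilinear G"
  shows "sweedler a (\<lambda>x y. G (\<pi> x) y) = G (\<pi> 1) a"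
proof -
  have "tensor_lift G (sweedler a (\<lambda>x y. \<pi> x \<otimes> y)) = tensor_lift G (\<pi> 1 \<otimes> a)"
    using assms(1) by (simp add: homogeneous_space_iff)
  with assms(2) show ?thesis
    by (simp add: sweedler_def tensor_lift_tensor_lift)
qed

lemma subspace_homogeneous: "complex_vector.subspace B"
proof -
  have lin: "clinear (\<lambda>a. sweedler a (\<lambda>x y. \<pi> x \<otimes> y))" "clinear (\<lambda>a. \<pi> 1 \<otimes> a)"
    by (intro linear_intros)+
  show ?thesis
    by (auto simp: complex_vector.subspace_def homogeneous_space_iff pure_add_right pure_scaleC_right
        clinear_add[OF lin(1)] clinear_scaleC[OF lin(1)] clinear_zero[OF lin(1)] clinear_zero[OF lin(2)])
qed

lemmas sweedler_in_B = sweedler_subspace[OF subspace_homogeneous]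

lemma one_in_B: "1 \<in> B"
  by (simp add: homogeneous_space_iff sweedler_one linear_intros)

text \<open>As \<open>\<pi>\<close> is a morphism of left modules, the condition on \<open>b\<close>
  turns \<open>\<pi> (x * y)\<close> into \<open>mact x (\<pi> 1)\<close>, which is
  \<open>\<pi> x\<close>; the condition on \<open>a\<close> does the rest.\<close>

lemma mult_in_B:
  assumes "a \<in> B" "b \<in> B"
  shows "a * b \<in> B"
proof -
  have "sweedler (a * b) (\<lambda>x y. \<pi> x \<otimes> y) = sweedler a (\<lambda>x x'. sweedler b (\<lambda>y y'. \<pi> (x * y) \<otimes> (x' * y')))"
    by (rule sweedler_mult) (intro linear_intros)
  also have "\<dots> = sweedler a (\<lambda>x x'. mact x (\<pi> 1) \<otimes> (x' * b))"
    unfolding pi_mult by (intro sweedler_cong sweedler_homogeneous assms linear_intros)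
  also have "\<dots> = sweedler a (\<lambda>x x'. \<pi> x \<otimes> (x' * b))"
    by (simp flip: pi_mult)
  also have "\<dots> = \<pi> 1 \<otimes> (a * b)"
    by (intro sweedler_homogeneous assms linear_intros)
  finally show ?thesis by (simp add: homogeneous_space_iff)
qed

text \<open>The condition concerns the first leg and the action the last one, so the two commute by
  coassociativity.\<close>

lemma act_in_B:
  assumes "a \<in> B"
  shows "act X a \<in> B"
proof -
  have lin: "clinear (\<lambda>a. sweedler a (\<lambda>x y. \<pi> x \<otimes> y))"
    by (intro linear_intros)
  have "sweedler (act X a) (\<lambda>x y. \<pi> x \<otimes> y) = sweedler a (\<lambda>x z. sweedler x (\<lambda>x y. pair X z *\<^sub>C (\<pi> x \<otimes> y)))"
    unfolding action_def
    by (simp add: clinear_sweedler[OF lin] clinear_scaleC[OF lin] scaleC_sweedler)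
  also have "\<dots> = sweedler a (\<lambda>x y. sweedler y (\<lambda>y z. pair X z *\<^sub>C (\<pi> x \<otimes> y)))"
    by (rule sweedler_assoc; intro linear_intros)
  also have "\<dots> = sweedler a (\<lambda>x y. \<pi> x \<otimes> act X y)"
  proof (intro sweedler_cong)
    fix x y
    have lin: "clinear (\<lambda>y. \<pi> x \<otimes> y)"
      by (intro linear_intros)
    show "sweedler y (\<lambda>y z. pair X z *\<^sub>C (\<pi> x \<otimes> y)) = \<pi> x \<otimes> act X y"
      by (simp add: action_def clinear_sweedler[OF lin] clinear_scaleC[OF lin])
  qed
  also have "\<dots> = \<pi> 1 \<otimes> act X a"
    by (intro sweedler_homogeneous assms linear_intros)
  finally show ?thesis by (simp add: homogeneous_space_iff)
qed

text \<open>First the sum of \<open>\<pi> (?T a\<^sub>1) \<otimes> a\<^sub>2\<close> is shown to be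
  \<open>\<pi> 1 \<otimes> a\<close>, with \<open>?T\<close> the inverse antipode. Applying
  \<open>\<tau>\<^sub>K\<close> and \<open>star\<close> to the two legs then gives the claim, since
  \<open>tau (?T x)\<close> is \<open>star x\<close>.\<close>

lemma star_in_B:
  assumes "a \<in> B"
  shows "star a \<in> B"
proof -
  let ?T = "\<lambda>a::'a. tau (star a)"
  have "sweedler a (\<lambda>x y. \<pi> (?T x) \<otimes> y) = sweedler a (\<lambda>x y. mact (?T x) (\<pi> 1) \<otimes> y)"
    by (simp flip: pi_mult)
  \<comment> \<open>Membership of \<open>a\<close> is used backwards: \<open>\<pi> 1\<close> expands
    to \<open>\<pi>\<close> of a new first leg, which the adjacent \<open>?T\<close>
    cancels.\<close>
  also have "\<dots> = sweedler a (\<lambda>x y. sweedler y (\<lambda>y z. mact (?T y) (\<pi> x) \<otimes> z))"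
    by (intro sweedler_homogeneous[symmetric, where G = "\<lambda>k a. sweedler a (\<lambda>x y. mact (?T x) k \<otimes> y)"]
        assms linear_intros)
  also have "\<dots> = sweedler a (\<lambda>x z. sweedler x (\<lambda>x y. \<pi> (?T y * x) \<otimes> z))"
    unfolding pi_mult by (rule sweedler_assoc[symmetric]; intro linear_intros)
  also have "\<dots> = sweedler a (\<lambda>x z. counit x *\<^sub>C (\<pi> 1 \<otimes> z))"
    by (intro sweedler_cong sweedler_tau_star_left[where f = "\<lambda>w. \<pi> w \<otimes> _"] linear_intros)
  also have "\<dots> = \<pi> 1 \<otimes> a"
    by (intro sweedler_counit_left linear_intros)
  finally have T: "sweedler a (\<lambda>x y. \<pi> (?T x) \<otimes> y) = \<pi> 1 \<otimes> a" .
  \<comment> \<open>Both legs are mapped antilinearly, so this map is balanced rather than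
    bilinear.\<close>
  have bal: "balanced (\<lambda>k y. \<tau>\<^sub>K k \<otimes> star y)"
    using antilinear_tau
    by (simp add: balanced_def antilinear_def star_add star_scaleC
        pure_add_left pure_add_right pure_scaleC_left pure_scaleC_right)
  have tauT: "\<tau>\<^sub>K (\<pi> (?T x)) = \<pi> (star x)" for x
    by (simp add: tau_pi tau_def[of "?T x"] antipode_tau_star)
  have "sweedler (star a) (\<lambda>x y. \<pi> x \<otimes> y) = sweedler a (\<lambda>x y. \<tau>\<^sub>K (\<pi> (?T x)) \<otimes> star y)"
    by (simp add: sweedler_star linear_intros tauT)
  also have "\<dots> = tensor_lift (\<lambda>k y. \<tau>\<^sub>K k \<otimes> star y) (sweedler a (\<lambda>x y. \<pi> (?T x) \<otimes> y))"
    by (simp add: additive_sweedler[where g = "tensor_lift (\<lambda>k y. \<tau>\<^sub>K k \<otimes> star y)"]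
        tensor_lift_add[OF bal] tensor_lift_pure[OF bal])
  also have "\<dots> = \<pi> 1 \<otimes> star a"
    by (simp only: T tensor_lift_pure[OF bal] tau_pi) (simp add: tau_def)
  finally show ?thesis by (simp add: homogeneous_space_iff)
qed

lemmas in_B = one_in_B mult_in_B act_in_B star_in_B

section \<open>Weights and the antipode-free form of quasi-invariance\<close>

lemma conv_act_in_B: "a \<in> B \<Longrightarrow> range f \<subseteq> B \<Longrightarrow> conv (\<lambda>X. act X a) f X \<in> B"
  unfolding conv_def by (intro sweedler_in_B in_B) auto

lemma conv_act_mult:
  "clinear f \<Longrightarrow> conv (\<lambda>X. act X (a * b)) f = conv (\<lambda>X. act X a) (conv (\<lambda>X. act X b) f)"
  by (simp add: act_mult conv_assoc[symmetric] clinear_act(2))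

lemma is_weight_mult:
  "is_weight pair \<pi> \<phi> \<Longrightarrow> \<phi> (X * Y) = conv (\<lambda>X. act X (\<phi> Y)) \<phi> X"
  by (simp add: is_weight_def conv_def)

lemma weightD:
  assumes "is_weight pair \<pi> \<phi>"
  shows "clinear \<phi>" "\<phi> X \<in> B" "\<phi> 1 = 1"
  using assms by (auto simp: is_weight_def)

text \<open>Once \<open>a\<close> is split off, the remaining convolution is the product rule of the
  weight read backwards.\<close>

lemma conv_act_weight:
  assumes "is_weight pair \<pi> \<phi>"
  shows "conv (\<lambda>X. act X (a * \<phi> Y)) \<phi> X = sweedler X (\<lambda>x y. act x a * \<phi> (y * Y))"
  by (simp add: conv_act_mult weightD[OF assms])
    (simp add: conv_def[of "\<lambda>X. act X a"] is_weight_mult[OF assms, symmetric])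

text \<open>Each condition yields the other by contracting an antipode. \<open>?Q1\<close> is used
  at \<open>b = a * \<phi> (?S y)\<close>; in the converse, \<open>?QI\<close> is used at an element
  that compensates the factor \<open>\<phi> (?S y)\<close>.\<close>

lemma quasi_invariant_iff_clinear:
  assumes w: "is_weight pair \<pi> \<phi>" and g: "clinear g"
  shows "(\<forall>X. \<forall>a\<in>B. g (act X a) = sweedler X (\<lambda>x y. g (star (\<phi> (star x)) * a * \<phi> (antipode y)))) \<longleftrightarrow>
    (\<forall>X. \<forall>b\<in>B. g (star (\<phi> (star X)) * b) = g (conv (\<lambda>x. act x b) \<phi> X))"
    (is "?QI \<longleftrightarrow> ?Q1")
proof -
  note [linear_intros] = clinear_comp[OF weightD(1)[OF w]] clinear_comp[OF g]
    clinear_comp[OF clinear_star_star[OF weightD(1)[OF w]]]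
  let ?S = "antipode :: 'u \<Rightarrow> 'u" and ?\<psi> = "\<lambda>X. star (\<phi> (star X))"
  show ?thesis
  proof
    assume q: ?Q1
    show ?QI
    proof (intro allI ballI)
      fix X a assume a: "a \<in> B"
      have "sweedler X (\<lambda>x y. g (?\<psi> x * a * \<phi> (?S y)))
          = sweedler X (\<lambda>x z. sweedler x (\<lambda>x y. g (act x a * \<phi> (y * ?S z))))"
      proof (intro sweedler_cong)
        fix x y
        have "g (?\<psi> x * a * \<phi> (?S y)) = g (conv (\<lambda>x. act x (a * \<phi> (?S y))) \<phi> x)"
          using q a by (simp add: mult.assoc mult_in_B weightD[OF w])
        also have "\<dots> = sweedler x (\<lambda>x z. g (act x a * \<phi> (z * ?S y)))"
          by (simp add: conv_act_weight w clinear_sweedler[OF g])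
        finally show "g (?\<psi> x * a * \<phi> (?S y)) = sweedler x (\<lambda>x z. g (act x a * \<phi> (z * ?S y)))" .
      qed
      also have "\<dots> = sweedler X (\<lambda>x y. sweedler y (\<lambda>y z. g (act x a * \<phi> (y * ?S z))))"
        by (rule sweedler_assoc; intro linear_intros)
      also have "\<dots> = sweedler X (\<lambda>x y. counit y *\<^sub>C g (act x a * \<phi> 1))"
        by (intro sweedler_cong sweedler_antipode_right[where f = "\<lambda>z. g (act _ a * \<phi> z)"] linear_intros)
      also have "\<dots> = g (act X a * \<phi> 1)"
        by (intro sweedler_counit_right linear_intros)
      finally show "g (act X a) = sweedler X (\<lambda>x y. g (?\<psi> x * a * \<phi> (?S y)))"
        by (simp add: weightD[OF w])
    qed
  next
    assume q: ?QI
    show ?Q1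
    proof (intro allI ballI)
      fix X b assume b: "b \<in> B"
      \<comment> \<open>\<open>?c\<close> solves two equations at once: in \<open>act_c\<close> the
        action cancels its antipode and leaves \<open>\<phi>\<close>, while in \<open>c_mult\<close>
        it combines with \<open>\<phi> (?S v)\<close> to the weight of an antipode
        contraction.\<close>
      let ?c = "\<lambda>y. sweedler y (\<lambda>p q. b * act (?S p) (\<phi> q))"
      have c: "?c y \<in> B" for y
        by (intro sweedler_in_B in_B b weightD[OF w])
      have act_c: "sweedler X (\<lambda>x y. act x (?c y)) = conv (\<lambda>x. act x b) \<phi> X"
      proof -
        have "act x (b * act (?S p) (\<phi> q)) = sweedler x (\<lambda>u v. act u b * act (v * ?S p) (\<phi> q))" for x p q
          by (simp add: act_mult conv_def act_act)
        then have "sweedler X (\<lambda>x y. act x (?c y)) = sweedler X (\<lambda>x y. sweedler y (\<lambda>p q.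
            sweedler x (\<lambda>u v. act u b * act (v * ?S p) (\<phi> q))))"
          by (simp add: clinear_sweedler[OF clinear_act(1)])
        also have "\<dots> = sweedler X (\<lambda>x y. sweedler x (\<lambda>u v. sweedler y (\<lambda>p q.
            act u b * act (v * ?S p) (\<phi> q))))"
          by (intro sweedler_cong sweedler_swap)
        also have "\<dots> = sweedler X (\<lambda>u y. sweedler y (\<lambda>v y. sweedler y (\<lambda>p q.
            act u b * act (v * ?S p) (\<phi> q))))"
          by (rule sweedler_assoc; intro linear_intros)
        also have "\<dots> = sweedler X (\<lambda>u y. sweedler y (\<lambda>v q. sweedler v (\<lambda>v p.
            act u b * act (v * ?S p) (\<phi> q))))"
          by (intro sweedler_cong sweedler_assoc[symmetric]; intro linear_intros)
        also have "\<dots> = sweedler X (\<lambda>u y. sweedler y (\<lambda>v q. counit v *\<^sub>C (act u b * act 1 (\<phi> q))))"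
          by (intro sweedler_cong sweedler_antipode_right[where f = "\<lambda>z. act _ b * act z (\<phi> _)"] linear_intros)
        also have "\<dots> = sweedler X (\<lambda>u y. act u b * act 1 (\<phi> y))"
          by (intro sweedler_cong sweedler_counit_left linear_intros)
        finally show ?thesis by (simp add: conv_def)
      qed
      have c_mult: "sweedler Y (\<lambda>v y. ?c y * \<phi> (?S v)) = counit Y *\<^sub>C b" for Y
      proof -
        have "sweedler Y (\<lambda>v y. ?c y * \<phi> (?S v))
            = sweedler Y (\<lambda>v y. sweedler y (\<lambda>p q. b * (act (?S p) (\<phi> q) * \<phi> (?S v))))"
          by (simp add: sweedler_mult_left mult.assoc)
        also have "\<dots> = sweedler Y (\<lambda>v q. sweedler v (\<lambda>v p. b * (act (?S p) (\<phi> q) * \<phi> (?S v))))"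
          by (rule sweedler_assoc[symmetric]; intro linear_intros)
        also have "\<dots> = sweedler Y (\<lambda>v q. b * \<phi> (?S v * q))"
        proof (intro sweedler_cong)
          fix v q
          \<comment> \<open>The antipode reverses the coproduct, which is why the legs
            \<open>p\<close> and \<open>v\<close> occur here in exactly the order found in the
            sum.\<close>
          have "\<phi> (?S v * q) = sweedler v (\<lambda>v p. act (?S p) (\<phi> q) * \<phi> (?S v))"
            unfolding is_weight_mult[OF w] conv_def by (rule sweedler_antipode) (intro linear_intros)
          then show "sweedler v (\<lambda>v p. b * (act (?S p) (\<phi> q) * \<phi> (?S v))) = b * \<phi> (?S v * q)"
            by (simp add: sweedler_mult_right)
        qed
        also have "\<dots> = counit Y *\<^sub>C (b * \<phi> 1)"
          by (intro sweedler_antipode_left[where f = "\<lambda>z. b * \<phi> z"] linear_intros)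
        finally show ?thesis by (simp add: weightD[OF w])
      qed
      have "g (conv (\<lambda>x. act x b) \<phi> X) = sweedler X (\<lambda>x y. g (act x (?c y)))"
        by (simp add: clinear_sweedler[OF g] flip: act_c)
      also have "\<dots> = sweedler X (\<lambda>x y. sweedler x (\<lambda>u v. g (?\<psi> u * ?c y * \<phi> (?S v))))"
        using q c by (intro sweedler_cong) blast
      also have "\<dots> = sweedler X (\<lambda>u y. sweedler y (\<lambda>v y. g (?\<psi> u * ?c y * \<phi> (?S v))))"
        by (rule sweedler_assoc; intro linear_intros)
      also have "\<dots> = sweedler X (\<lambda>u y. g (?\<psi> u * sweedler y (\<lambda>v y. ?c y * \<phi> (?S v))))"
      proof -
        have "sweedler y (\<lambda>v y. g (c * f y * e v)) = g (c * sweedler y (\<lambda>v y. f y * e v))" for c f e y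
          by (simp add: clinear_sweedler[OF g] sweedler_mult_right mult.assoc)
        then show ?thesis by (intro sweedler_cong)
      qed
      also have "\<dots> = sweedler X (\<lambda>u y. counit y *\<^sub>C g (?\<psi> u * b))"
        by (simp add: c_mult mult_scaleC_right clinear_scaleC[OF g])
      also have "\<dots> = g (?\<psi> X * b)"
        by (intro sweedler_counit_right linear_intros)
      finally show "g (?\<psi> X * b) = g (conv (\<lambda>x. act x b) \<phi> X)" ..
    qed
  qed
qed

text \<open>Every argument of \<open>h\<close> that occurs lies in \<open>B\<close>, so
  \<open>h\<close> can be exchanged for a linear extension.\<close>

lemma quasi_invariant_iff:
  assumes "real_functional \<pi> h" "is_weight pair \<pi> \<phi>"
  shows "quasi_invariant pair \<pi> h \<phi> \<longleftrightarrow>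
    (\<forall>X. \<forall>b\<in>B. h (star (\<phi> (star X)) * b) = h (conv (\<lambda>x. act x b) \<phi> X))"
proof -
  obtain g where g: "clinear g" "\<And>a. a \<in> B \<Longrightarrow> g a = h a"
    using real_functional_extend[OF subspace_homogeneous assms(1)] by metis
  have range: "range \<phi> \<subseteq> B"
    using assms(2) by (simp add: is_weight_def)
  have "sweedler X (\<lambda>x y. g (star (\<phi> (star x)) * a * \<phi> (antipode y)))
      = sweedler X (\<lambda>x y. h (star (\<phi> (star x)) * a * \<phi> (antipode y)))" if "a \<in> B" for X a
    by (intro sweedler_cong g in_B that weightD[OF assms(2)])
  with quasi_invariant_iff_clinear[OF assms(2) g(1)] show ?thesis
    unfolding quasi_invariant_def
    by (simp add: assms g in_B weightD[OF assms(2)] conv_act_in_B range)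
qed

section \<open>Change of weight under equivalence\<close>

text \<open>The product rule of a weight is a multiplicative cocycle condition, and twisting by
  \<open>\<xi>\<close> passes to a cohomologous cocycle.\<close>

lemma xi_equivalent_weight:
  assumes w: "is_weight pair \<pi> \<phi>" and \<xi>: "\<xi> \<in> B" "\<eta> \<in> B" "\<xi> * \<eta> = 1" "\<eta> * \<xi> = 1"
  shows "is_weight pair \<pi> (\<lambda>X. conv (\<lambda>X. act X \<xi>) \<phi> X * \<eta>)" (is "is_weight pair \<pi> ?\<phi>")
proof -
  note [linear_intros] = clinear_comp[OF weightD(1)[OF w]]
  have lin: "clinear (conv (\<lambda>X. act X \<xi>) \<phi>)"
    by (intro clinear_conv clinear_act weightD[OF w])
  have range: "range \<phi> \<subseteq> B"
    using w by (simp add: is_weight_def)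
  have "?\<phi> (X * Y) = conv (\<lambda>X. act X (?\<phi> Y)) ?\<phi> X" for X Y
  proof -
    have eq: "act (x * y) \<xi> * \<phi> (x' * y') = sweedler x' (\<lambda>u v. act x (act y \<xi>) * (act u (\<phi> y') * \<phi> v))"
      for x x' y y'
      by (simp add: act_act is_weight_mult[OF w] conv_def sweedler_mult_right)
    have "conv (\<lambda>X. act X \<xi>) \<phi> (X * Y)
        = sweedler X (\<lambda>x x'. sweedler Y (\<lambda>y y'. act (x * y) \<xi> * \<phi> (x' * y')))"
      unfolding conv_def by (rule sweedler_mult) (intro linear_intros)
    also have "\<dots> = sweedler Y (\<lambda>y y'. sweedler X (\<lambda>x x'. act (x * y) \<xi> * \<phi> (x' * y')))"
      by (rule sweedler_swap)
    also have "\<dots> = sweedler Y (\<lambda>y y'. conv (\<lambda>X. act X (act y \<xi> * \<phi> y')) \<phi> X)"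
      by (simp add: conv_act_mult weightD[OF w] eq sweedler_mult_right) (simp add: conv_def sweedler_mult_right)
    also have "\<dots> = conv (\<lambda>X. act X (conv (\<lambda>X. act X \<xi>) \<phi> Y)) \<phi> X"
    proof -
      have "clinear (\<lambda>a. conv (\<lambda>X. act X a) \<phi> X)"
        unfolding conv_def by (intro linear_intros)
      from clinear_sweedler[OF this, symmetric] show ?thesis
        unfolding conv_def[of "\<lambda>X. act X \<xi>" \<phi> Y] .
    qed
    \<comment> \<open>The trailing \<open>\<eta>\<close> of \<open>?\<phi> Y\<close> cancels the
      inserted \<open>\<xi>\<close>; that \<open>\<xi>\<close> is then split off to complete the
      second weight.\<close>
    also have "\<dots> = conv (\<lambda>X. act X (?\<phi> Y * \<xi>)) \<phi> X"
      by (simp add: mult.assoc \<xi>)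
    also have "\<dots> = conv (\<lambda>X. act X (?\<phi> Y)) (conv (\<lambda>X. act X \<xi>) \<phi>) X"
      by (simp add: conv_act_mult weightD[OF w])
    finally show ?thesis by (simp add: conv_mult_right)
  qed
  moreover have "?\<phi> 1 = 1"
    by (simp add: conv_def sweedler_one linear_intros weightD[OF w] \<xi>)
  moreover have "clinear ?\<phi>"
    by (intro linear_intros lin)
  moreover have "range ?\<phi> \<subseteq> B"
    by (auto intro!: in_B conv_act_in_B \<xi> range)
  ultimately show ?thesis by (auto simp: is_weight_def conv_def)
qed

text \<open>The antipode-free condition is checked. The inverse is an explicit parameter
  \<open>\<eta>\<close>, so that the lemma can also be applied with \<open>\<xi>\<close> and its
  inverse exchanged.\<close>

lemma xi_equivalent_quasi_invariant:
  assumes q: "quasi_invariant pair \<pi> h2 \<phi>" and h1: "real_functional \<pi> h1"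
    and h12: "\<And>a. a \<in> B \<Longrightarrow> h1 a = h2 (star \<xi> * a * \<xi>)"
    and \<xi>: "\<xi> \<in> B" "\<eta> \<in> B" "\<xi> * \<eta> = 1" "\<eta> * \<xi> = 1"
  shows "quasi_invariant pair \<pi> h1 (\<lambda>X. conv (\<lambda>X. act X \<xi>) \<phi> X * \<eta>)"
proof -
  have h2: "real_functional \<pi> h2" and w: "is_weight pair \<pi> \<phi>"
    using q by (auto simp: quasi_invariant_def)
  note [linear_intros] = clinear_comp[OF weightD(1)[OF w]]
  let ?\<phi> = "\<lambda>X. conv (\<lambda>X. act X \<xi>) \<phi> X * \<eta>"
  let ?T = "\<lambda>X::'u. tau (star X)"
  have w1: "is_weight pair \<pi> ?\<phi>"
    using w \<xi> by (rule xi_equivalent_weight)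
  have range: "range \<phi> \<subseteq> B" "range ?\<phi> \<subseteq> B"
    using w w1 by (simp_all add: is_weight_def)
  obtain g where g: "clinear g" "\<And>a. a \<in> B \<Longrightarrow> g a = h2 a"
    using real_functional_extend[OF subspace_homogeneous h2] by metis
  note [linear_intros] = clinear_comp[OF g(1)]
  have q1: "g (star (\<phi> (star X)) * b) = g (conv (\<lambda>x. act x b) \<phi> X)" if "b \<in> B" for X b
    using quasi_invariant_iff[OF h2 w] q that
    by (simp add: g in_B weightD[OF w] conv_act_in_B range)
  have "h1 (star (?\<phi> (star X)) * b) = h1 (conv (\<lambda>x. act x b) ?\<phi> X)" if b: "b \<in> B" for X b
  proof -
    let ?G = "conv (\<lambda>x. act x (b * \<xi>)) \<phi>"
    have G: "clinear ?G"
      by (intro clinear_conv clinear_act weightD[OF w])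
    note [linear_intros] = clinear_comp[OF G]
    have "h1 (star c * b) = g (star (c * \<xi>) * (b * \<xi>))" if "c \<in> B" for c
      using b that by (simp add: h12 g in_B \<xi>(1) star_mult mult.assoc)
    then have "h1 (star (?\<phi> (star X)) * b) = g (star (?\<phi> (star X) * \<xi>) * (b * \<xi>))"
      using weightD(2)[OF w1] by blast
    \<comment> \<open>The factor \<open>\<xi>\<close> removes \<open>\<eta>\<close>; then
      \<open>star\<close> reverses the product and, by \<open>star_act\<close>, turns the action of
      \<open>star x\<close> on \<open>\<xi>\<close> into that of \<open>?T x\<close> on
      \<open>star \<xi>\<close>.\<close>
    also have "\<dots> = sweedler X (\<lambda>x y. g (star (\<phi> (star y)) * (act (?T x) (star \<xi>) * (b * \<xi>))))"
    proof -
      have "?\<phi> (star X) * \<xi> = sweedler X (\<lambda>x y. act (star x) \<xi> * \<phi> (star y))"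
        by (simp add: mult.assoc \<xi>) (simp add: conv_def sweedler_star linear_intros)
      then have "star (?\<phi> (star X) * \<xi>) = sweedler X (\<lambda>x y. star (\<phi> (star y)) * act (?T x) (star \<xi>))"
        by (simp add: star_sweedler star_mult star_act)
      then show ?thesis
        by (simp only: sweedler_mult_left clinear_sweedler[OF g(1)] mult.assoc)
    qed
    also have "\<dots> = sweedler X (\<lambda>x y. g (conv (\<lambda>X. act X (act (?T x) (star \<xi>) * (b * \<xi>))) \<phi> y))"
      by (intro sweedler_cong q1 in_B b \<xi>)
    also have "\<dots> = sweedler X (\<lambda>x y. sweedler y (\<lambda>u v. g (act (u * ?T x) (star \<xi>) * ?G v)))"
      by (simp add: conv_act_mult[of \<phi> "act _ _"] weightD[OF w])
        (simp add: conv_def[of _ ?G] act_act clinear_sweedler[OF g(1)])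
    also have "\<dots> = sweedler X (\<lambda>x v. sweedler x (\<lambda>x u. g (act (u * ?T x) (star \<xi>) * ?G v)))"
      by (rule sweedler_assoc[symmetric]; intro linear_intros)
    \<comment> \<open>The regrouping has brought \<open>u\<close> next to \<open>?T x\<close>; their
      contraction leaves \<open>star \<xi>\<close> untouched in front, as needed to return to
      \<open>h1\<close>.\<close>
    also have "\<dots> = sweedler X (\<lambda>x v. counit x *\<^sub>C g (act 1 (star \<xi>) * ?G v))"
      by (intro sweedler_cong sweedler_tau_star_right[where f = "\<lambda>z. g (act z (star \<xi>) * ?G _)"] linear_intros)
    also have "\<dots> = g (act 1 (star \<xi>) * ?G X)"
      by (intro sweedler_counit_left linear_intros)
    also have "?G X = conv (\<lambda>x. act x b) ?\<phi> X * \<xi>"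
      by (simp add: conv_act_mult weightD[OF w] conv_mult_right mult.assoc \<xi>)
    also have "g (act 1 (star \<xi>) * (conv (\<lambda>x. act x b) ?\<phi> X * \<xi>)) = h1 (conv (\<lambda>x. act x b) ?\<phi> X)"
      using b by (simp add: h12 g in_B conv_act_in_B range \<xi>(1) mult.assoc)
    finally show ?thesis .
  qed
  then show ?thesis
    by (simp add: quasi_invariant_iff[OF h1 w1])
qed

section \<open>Invariance as the case of the trivial weight\<close>

lemma is_weight_counit: "is_weight pair \<pi> (\<lambda>X. counit X *\<^sub>C 1)"
proof -
  have lin: "clinear (\<lambda>X::'u. counit X *\<^sub>C (1::'a))"
    by (intro linear_intros)
  have "act x (counit Y *\<^sub>C 1) * (counit y *\<^sub>C 1) = counit y *\<^sub>C counit Y *\<^sub>C counit x *\<^sub>C (1::'a)" for x y Y :: 'u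
    by (simp add: clinear_scaleC[OF clinear_act(1)] mult_scaleC_right)
  moreover have "sweedler X (\<lambda>x y. counit y *\<^sub>C counit Y *\<^sub>C counit x *\<^sub>C (1::'a))
      = counit Y *\<^sub>C counit X *\<^sub>C 1" for X Y :: 'u
    by (rule sweedler_counit_right) (intro linear_intros)
  ultimately show ?thesis
    using lin by (auto simp: is_weight_def counit_one scaleC_one one_in_B
        complex_vector.subspace_scale[OF subspace_homogeneous] counit_mult scaleC_scaleC mult.commute)
qed

text \<open>For the trivial weight the antipode-free condition reads
  \<open>counit X * h b = h (act X b)\<close>.\<close>

lemma invariant_iff: "invariant pair \<pi> h \<longleftrightarrow> quasi_invariant pair \<pi> h (\<lambda>X. counit X *\<^sub>C 1)"
proof (cases "real_functional \<pi> h")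
  case True
  have h: "h (star (counit (star X) *\<^sub>C 1) * b) = counit X * h b" if "b \<in> B" for X b
    using True that by (simp add: counit_star star_scaleC mult_scaleC_left real_functional_def)
  have act: "conv (\<lambda>x. act x b) (\<lambda>X. counit X *\<^sub>C 1) X = act X b" for X b
    by (rule conv_counit_right) (intro linear_intros)
  show ?thesis
    unfolding quasi_invariant_iff[OF True is_weight_counit] invariant_def act
    using True h by metis
qed (simp add: invariant_def quasi_invariant_def)

lemma real_functional_conjugate:
  assumes "real_functional \<pi> h" "\<eta> \<in> B"
  shows "real_functional \<pi> (\<lambda>a. h (star \<eta> * a * \<eta>))"
proof -
  have "star \<eta> * star a * \<eta> = star (star \<eta> * a * \<eta>)" for a
    by (simp add: star_mult star_star mult.assoc)
  then show ?thesis
    using assms by (simp add: real_functional_def in_B mult_scaleC_left mult_scaleC_right distrib_left distrib_right)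
qed

section \<open>Translates by group-like elements and essential invariance\<close>

text \<open>For group-like \<open>k\<close> the quasi-invariance sum has the single term
  \<open>h (star (\<phi> (star k)) * a * \<phi> (antipode k))\<close>. Since
  \<open>tau k = k\<close> gives \<open>star k = antipode k\<close>, this is conjugation by
  \<open>\<phi> (antipode k)\<close>.\<close>

lemma quasi_invariant_group_like:
  assumes q: "quasi_invariant pair \<pi> h \<phi>" and k: "group_like k" "tau k = k"
  shows "xi_equivalent \<pi> (\<phi> (antipode k)) (\<lambda>a. h (act k a)) h"
    and "quasi_invariant pair \<pi> (\<lambda>a. h (act k a)) (\<lambda>X. \<phi> (X * antipode k) * act (antipode k) (\<phi> k))"
    and "positive_functional \<pi> h \<Longrightarrow> positive_functional \<pi> (\<lambda>a. h (act k a))"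
proof -
  let ?l = "antipode k" and ?\<xi> = "\<phi> (antipode k)" and ?\<eta> = "act (antipode k) (\<phi> k)"
  have h: "real_functional \<pi> h" and w: "is_weight pair \<pi> \<phi>"
    using q by (auto simp: quasi_invariant_def)
  note [linear_intros] = clinear_comp[OF weightD(1)[OF w]]
  have l: "group_like ?l" "star k = ?l"
    using k group_like_antipode star_star[of ?l] by (auto simp: tau_def)
  have act_mult: "act m (a * b) = act m a * act m b" "\<phi> (m * Y) = act m (\<phi> Y) * \<phi> m"
    if "group_like m" for m a b Y
    using that by (simp_all add: act_mult is_weight_mult[OF w] conv_def sweedler_group_like linear_intros)
  note kl = group_like_antipode_mult[OF k(1)]
  \<comment> \<open>The product rule at \<open>k * antipode k = 1\<close>, acted on by
    \<open>antipode k\<close>, gives \<open>?\<xi> * ?\<eta> = 1\<close>; at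
    \<open>antipode k * k = 1\<close> it gives \<open>?\<eta> * ?\<xi> = 1\<close> directly.\<close>
  have "act ?l (act k ?\<xi> * \<phi> k) = act ?l 1"
    by (simp add: act_mult(2)[OF k(1), symmetric] kl weightD[OF w])
  then have \<xi>: "?\<xi> \<in> B" "?\<eta> \<in> B" "?\<xi> * ?\<eta> = 1" "?\<eta> * ?\<xi> = 1"
    by (simp_all add: act_mult(1)[OF l(1)] act_mult(2)[OF l(1), symmetric] act_act kl
        group_like_counit l scaleC_one in_B weightD[OF w])
  have star: "act k (star a) = star (act k a)" for a
    by (simp add: star_act k)
  have hk: "h (act k a) = h (star ?\<xi> * a * ?\<xi>)" if a: "a \<in> B" for a
  proof -
    obtain g where g: "clinear g" "\<And>a. a \<in> B \<Longrightarrow> g a = h a"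
      using real_functional_extend[OF subspace_homogeneous h] by metis
    note [linear_intros] = clinear_comp[OF g(1)] clinear_comp[OF clinear_star_star[OF weightD(1)[OF w]]]
    have "h (act k a) = sweedler k (\<lambda>x y. h (star (\<phi> (star x)) * a * \<phi> (antipode y)))"
      using q a by (simp add: quasi_invariant_def)
    also have "\<dots> = sweedler k (\<lambda>x y. g (star (\<phi> (star x)) * a * \<phi> (antipode y)))"
      by (intro sweedler_cong g(2)[symmetric] in_B a weightD[OF w])
    also have "\<dots> = g (star (\<phi> (star k)) * a * ?\<xi>)"
      by (intro sweedler_group_like k linear_intros)
    finally show ?thesis by (simp add: l g in_B a weightD[OF w])
  qed
  have real: "real_functional \<pi> (\<lambda>a. h (act k a))"
    using h by (simp add: real_functional_def star in_B clinear_add[OF clinear_act(1)] clinear_scaleC[OF clinear_act(1)])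
  show "xi_equivalent \<pi> ?\<xi> (\<lambda>a. h (act k a)) h"
    using \<xi> hk h real by (auto simp: xi_equivalent_def invertible_in_def)
  have "quasi_invariant pair \<pi> (\<lambda>a. h (act k a)) (\<lambda>X. conv (\<lambda>X. act X ?\<xi>) \<phi> X * ?\<eta>)"
    by (rule xi_equivalent_quasi_invariant[OF q real hk \<xi>])
  then show "quasi_invariant pair \<pi> (\<lambda>a. h (act k a)) (\<lambda>X. \<phi> (X * ?l) * ?\<eta>)"
    by (simp add: is_weight_mult[OF w])
  \<comment> \<open>A group-like \<open>k\<close> acts multiplicatively, and
    \<open>tau k = k\<close> makes its action commute with \<open>star\<close>, so
    \<open>star a * a\<close> goes to an element of the same shape.\<close>
  show "positive_functional \<pi> (\<lambda>a. h (act k a))" if "positive_functional \<pi> h"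
    using that real by (simp add: positive_functional_def act_mult(1)[OF k(1)] star in_B)
qed

lemma essentially_invariant_iff:
  assumes h: "real_functional \<pi> h"
  shows "essentially_invariant pair \<pi> h \<longleftrightarrow> (\<exists>h0. invariant pair \<pi> h0 \<and> equivalent \<pi> h h0)"
proof
  assume "essentially_invariant pair \<pi> h"
  then obtain \<xi> where \<xi>: "invertible_in B \<xi>"
    and q: "quasi_invariant pair \<pi> h (\<lambda>X. act X \<xi> * inverse_in B \<xi>)"
    by (auto simp: essentially_invariant_def)
  define \<eta> where "\<eta> = inverse_in B \<xi>"
  have \<eta>: "\<eta> \<in> B" "\<xi> \<in> B" "\<eta> * \<xi> = 1" "\<xi> * \<eta> = 1"
    using inverse_in[OF \<xi>] \<xi> by (auto simp: \<eta>_def invertible_in_def)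
  let ?h0 = "\<lambda>a. h (star \<eta> * a * \<eta>)"
  have h0: "real_functional \<pi> ?h0"
    by (rule real_functional_conjugate[OF h \<eta>(1)])
  \<comment> \<open>Changing the weight by \<open>\<eta>\<close> undoes the change by
    \<open>\<xi>\<close>: the convolution of the two actions is the action on
    \<open>\<eta> * \<xi> = 1\<close>.\<close>
  have "conv (\<lambda>X. act X \<eta>) (\<lambda>X. act X \<xi> * \<eta>) X * \<xi> = counit X *\<^sub>C 1" for X
    by (simp add: conv_mult_right flip: act_mult) (simp add: \<eta> mult.assoc)
  with xi_equivalent_quasi_invariant[OF q h0 _ \<eta>] have inv: "invariant pair \<pi> ?h0"
    by (simp add: invariant_iff \<eta>_def)
  have "star \<eta> * (star \<xi> * a * \<xi>) * \<eta> = a" for a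
  proof -
    have "star \<eta> * (star \<xi> * a * \<xi>) * \<eta> = star (\<xi> * \<eta>) * a * (\<xi> * \<eta>)"
      by (simp only: star_mult mult.assoc)
    then show ?thesis by (simp add: \<eta>)
  qed
  then have "equivalent \<pi> h ?h0"
    using h h0 \<xi> by (auto simp: equivalent_def xi_equivalent_def)
  with inv show "\<exists>h0. invariant pair \<pi> h0 \<and> equivalent \<pi> h h0" by blast
next
  assume "\<exists>h0. invariant pair \<pi> h0 \<and> equivalent \<pi> h h0"
  then obtain h0 \<xi> where h0: "invariant pair \<pi> h0" and \<xi>: "xi_equivalent \<pi> \<xi> h h0"
    by (auto simp: equivalent_def)
  then have inv: "invertible_in B \<xi>" and eq: "\<And>a. a \<in> B \<Longrightarrow> h a = h0 (star \<xi> * a * \<xi>)"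
    by (auto simp: xi_equivalent_def)
  then have "\<xi> \<in> B" by (simp add: invertible_in_def)
  \<comment> \<open>The trivial weight is the unit for convolution, so its change by
    \<open>\<xi>\<close> has exactly the form required of an essentially invariant weight.\<close>
  from xi_equivalent_quasi_invariant[OF h0[unfolded invariant_iff] h eq this inverse_in[OF inv]]
  have "quasi_invariant pair \<pi> h (\<lambda>X. act X \<xi> * inverse_in B \<xi>)"
    by (simp add: conv_counit_right clinear_act)
  with inv show "essentially_invariant pair \<pi> h"
    by (auto simp: essentially_invariant_def)
qed

end

theorem proposition3p8:
  fixes pair :: "'u::hopf_star_algebra \<Rightarrow> 'a::hopf_star_algebra \<Rightarrow> complex"
    and mact :: "'a \<Rightarrow> 'k::coalgebra \<Rightarrow> 'k"
    and \<pi> :: "'a \<Rightarrow> 'k"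
    and \<tau>\<^sub>K :: "'k \<Rightarrow> 'k"
  assumes "hopf_star_pairing pair"
    and "real_coisotropic_left_subgroup mact \<pi> \<tau>\<^sub>K"
  shows
    "(\<forall>h1 h2 \<xi> \<phi>2.
        real_functional \<pi> h1 \<and> real_functional \<pi> h2 \<and> xi_equivalent \<pi> \<xi> h1 h2 \<and>
        quasi_invariant pair \<pi> h2 \<phi>2 \<longrightarrow>
        quasi_invariant pair \<pi> h1
          (\<lambda>X. sweedler X (\<lambda>X1 X2. action pair X1 \<xi> * \<phi>2 X2 * inverse_in (homogeneous_space \<pi>) \<xi>))) \<and>
     (\<forall>h \<phi> k.
        quasi_invariant pair \<pi> h \<phi> \<and> group_like k \<and> tau k = k \<longrightarrow>
        real_functional \<pi> (\<lambda>a. h (action pair k a)) \<and>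
        equivalent \<pi> (\<lambda>a. h (action pair k a)) h \<and>
        quasi_invariant pair \<pi> (\<lambda>a. h (action pair k a))
          (\<lambda>X. \<phi> (X * antipode k) * action pair (antipode k) (\<phi> k)) \<and>
        (positive_functional \<pi> h \<longrightarrow> positive_functional \<pi> (\<lambda>a. h (action pair k a)))) \<and>
     (\<forall>h. real_functional \<pi> h \<longrightarrow>
        (essentially_invariant pair \<pi> h \<longleftrightarrow>
         (\<exists>h0. invariant pair \<pi> h0 \<and> equivalent \<pi> h h0)))"
proof -
  interpret coisotropic_pairing pair mact \<pi> \<tau>\<^sub>K
    using assms by (simp add: coisotropic_pairing_def)
  have "quasi_invariant pair \<pi> h1
      (\<lambda>X. sweedler X (\<lambda>X1 X2. act X1 \<xi> * \<phi>2 X2 * inverse_in B \<xi>))"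
    if h1: "real_functional \<pi> h1" and \<xi>: "xi_equivalent \<pi> \<xi> h1 h2"
      and q: "quasi_invariant pair \<pi> h2 \<phi>2" for h1 h2 \<xi> \<phi>2
  proof -
    have inv: "invertible_in B \<xi>" and eq: "\<And>a. a \<in> B \<Longrightarrow> h1 a = h2 (star \<xi> * a * \<xi>)"
      using \<xi> by (auto simp: xi_equivalent_def)
    then have "\<xi> \<in> B" by (simp add: invertible_in_def)
    from xi_equivalent_quasi_invariant[OF q h1 eq this inverse_in[OF inv]] show ?thesis
      by (simp add: conv_def sweedler_mult_left)
  qed
  moreover have "real_functional \<pi> (\<lambda>a. h (act k a))" "equivalent \<pi> (\<lambda>a. h (act k a)) h"
    if "quasi_invariant pair \<pi> h \<phi>" "group_like k" "tau k = k" for h \<phi> k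
    using quasi_invariant_group_like(1)[OF that] by (auto simp: equivalent_def xi_equivalent_def)
  ultimately show ?thesis
    using quasi_invariant_group_like(2,3) essentially_invariant_iff by blast
qed

end
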